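(* Let $\mathfrak{g}$ be the insertion-elimination algebra. Then $\mathrm{Der}_{\mathbb{C}}(\mathfrak{g})=\mathrm{Inn}_{\mathbb{C}}(\mathfrak{g})$, i.e. every $\mathbb{C}$-linear derivation of $\mathfrak{g}$ is inner, and thus $H^1(\mathfrak{g},\mathfrak{g})\cong\mathrm{Der}_{\mathbb{C}}(\mathfrak{g})/\mathrm{Inn}_{\mathbb{C}}(\mathfrak{g})$ is trivial.
   Context: A rooted tree is a finite connected undirected cycle-free graph $t$ with a distinguished vertex $\mathrm{rt}(t)$, its root. Rooted trees are considered up to (root-preserving graph) isomorphism; equality of rooted trees means isomorphism, and $\mathbb{T}$ is the set of all isomorphism classes of rooted trees. $V(t)$ and $E(t)$ are the sets of vertices and edges of $t$, and $|t|$ is the cardinality of $V(t)$. For $e\in E(t)$, removing $e$ divides $t$ into two rooted subtrees: $R_e(t)$ is the one containing $\mathrm{rt}(t)$, and $P_e(t)$ is the other one; a subtree is rooted at its vertex at minimal distance in $t$ from $\mathrm{rt}(t)$. For $s,t\in\mathbb{T}$ and $v\in V(s)$, $s\cup_v t$ is the rooted tree obtained by joining the root of $t$ to $s$ at $v$ by a single new edge, with root $\mathrm{rt}(s)$. For $t_1,t_2,t_3\in\mathbb{T}$ put $$\alpha(t_1,t_2,t_3)=|\{e\in E(t_2)\mid R_e(t_2)=t_3,\ P_e(t_2)=t_1\}|,\qquad \beta(t_1,t_2,t_3)=|\{v\in V(t_3)\mid t_1=t_3\cup_v t_2\}|.$$ The insertion-elimination algebra $\mathfrak{g}$ is the Lie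 algebra over $\mathbb{C}$ with basis $\{d\}\cup\{D_t^{+},D_t^-\mid t\in\mathbb{T}\}$ and relations, for $s,t\in\mathbb{T}$: $[D_s^+,D_t^+]=\sum_{r\in\mathbb{T}}(\beta(r,s,t)-\beta(r,t,s))D_r^+$; $[D_s^-,D_t^-]=\sum_{r\in\mathbb{T}}(\alpha(t,r,s)-\alpha(s,r,t))D_r^-$; $[D_s^-,D_t^+]=\sum_{r\in\mathbb{T}}\alpha(s,t,r)D_r^++\sum_{r\in\mathbb{T}}\beta(s,t,r)D_r^-$ for $s\neq t$; $[D_t^-,D_t^+]=d$; $[d,D_t^-]=-|t|D_t^-$; $[d,D_t^+]=|t|D_t^+$. $\mathrm{Der}_{\mathbb{C}}(\mathfrak{g})$ is the Lie algebra of $\mathbb{C}$-linear derivations $\mathfrak{g}\to\mathfrak{g}$ and $\mathrm{Inn}_{\mathbb{C}}(\mathfrak{g})$ its ideal of inner derivations $x\mapsto[x,y]$, $y\in\mathfrak{g}$. $H^1(\mathfrak{g},\mathfrak{g})$ is the first Lie algebra cohomology of $\mathfrak{g}$ with coefficients in the adjoint module. *)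

theory Defs
  imports
    Complex_Main
    "HOL-Library.Poly_Mapping"
    "HOL-Library.Function_Algebras"
    "HOL-Library.Set_Algebras"
begin

section \<open>Rooted trees\<close>

datatype 'a rgraph = RGraph (verts: "'a set") (edges: "'a set set") (root: 'a)

definition adj :: "'a set set \<Rightarrow> ('a \<times> 'a) set" where
  "adj E = {(u, v). {u, v} \<in> E}"

definition graph_cycle :: "'a set set \<Rightarrow> 'a list \<Rightarrow> bool" where
  "graph_cycle E vs \<longleftrightarrow> length vs \<ge> 3 \<and> distinct vs \<and>
     (\<forall>i < length vs. {vs ! i, vs ! (Suc i mod length vs)} \<in> E)"

definition rooted_tree :: "'a rgraph \<Rightarrow> bool" where
  "rooted_tree G \<longleftrightarrow>
     finite (verts G) \<and> root G \<in> verts G \<and>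
     (\<forall>e \<in> edges G. e \<subseteq> verts G \<and> card e = 2) \<and>
     (\<forall>u \<in> verts G. \<forall>v \<in> verts G. (u, v) \<in> (adj (edges G))\<^sup>*) \<and>
     (\<nexists>vs. graph_cycle (edges G) vs)"

text \<open>The two graphs may have different vertex types.\<close>

definition rgraph_iso :: "'a rgraph \<Rightarrow> 'b rgraph \<Rightarrow> bool" (infix "\<simeq>" 50) where
  "G \<simeq> H \<longleftrightarrow> (\<exists>f. bij_betw f (verts G) (verts H) \<and> f (root G) = root H \<and>
     (\<forall>u \<in> verts G. \<forall>v \<in> verts G. {u, v} \<in> edges G \<longleftrightarrow> {f u, f v} \<in> edges H))"

lemma rgraph_iso_refl: "G \<simeq> G"
  unfolding rgraph_iso_def by (rule exI[of _ id]) auto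

lemma rgraph_iso_trans:
  assumes "G \<simeq> H" "H \<simeq> K" shows "G \<simeq> K"
proof -
  obtain f where f: "bij_betw f (verts G) (verts H)" "f (root G) = root H"
    "\<forall>u \<in> verts G. \<forall>v \<in> verts G. {u, v} \<in> edges G \<longleftrightarrow> {f u, f v} \<in> edges H"
    using assms(1) unfolding rgraph_iso_def by blast
  obtain g where g: "bij_betw g (verts H) (verts K)" "g (root H) = root K"
    "\<forall>u \<in> verts H. \<forall>v \<in> verts H. {u, v} \<in> edges H \<longleftrightarrow> {g u, g v} \<in> edges K"
    using assms(2) unfolding rgraph_iso_def by blast
  have "f u \<in> verts H" if "u \<in> verts G" for u
    using f(1) that by (auto simp: bij_betw_def)
  then show ?thesis
    unfolding rgraph_iso_def using f g bij_betw_trans[OF f(1) g(1)]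
    by (intro exI[of _ "g \<circ> f"]) auto
qed

lemma rgraph_iso_sym:
  assumes "G \<simeq> H" "root G \<in> verts G" shows "H \<simeq> G"
proof -
  obtain f where f: "bij_betw f (verts G) (verts H)" "f (root G) = root H"
    "\<forall>u \<in> verts G. \<forall>v \<in> verts G. {u, v} \<in> edges G \<longleftrightarrow> {f u, f v} \<in> edges H"
    using assms(1) unfolding rgraph_iso_def by blast
  let ?g = "inv_into (verts G) f"
  have "bij_betw ?g (verts H) (verts G)"
    by (rule bij_betw_inv_into[OF f(1)])
  moreover have "?g (root H) = root G"
    using f(1,2) assms(2) by (metis bij_betw_inv_into_left)
  moreover have "?g u \<in> verts G \<and> f (?g u) = u" if "u \<in> verts H" for u
    using f(1) that by (metis bij_betw_inv_into_right bij_betwE bij_betw_inv_into)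
  ultimately show ?thesis
    unfolding rgraph_iso_def using f(3) by (intro exI[of _ ?g]) auto
qed

text \<open>Every finite graph is isomorphic to one with vertices in \<^typ>\<open>nat\<close>, so the
  following quotient is the set of all isomorphism classes of rooted trees.\<close>

quotient_type rtree = "nat rgraph" /
  partial: "\<lambda>G H. rooted_tree G \<and> rooted_tree H \<and> G \<simeq> H"
proof (rule part_equivpI)
  have "rooted_tree (RGraph {0::nat} {} 0)"
    by (auto simp: rooted_tree_def graph_cycle_def) (metis gr0I not_numeral_le_zero list.size(3))
  then show "\<exists>G::nat rgraph. rooted_tree G \<and> rooted_tree G \<and> G \<simeq> G"
    using rgraph_iso_refl by blast
  show "symp (\<lambda>G H::nat rgraph. rooted_tree G \<and> rooted_tree H \<and> G \<simeq> H)"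
    by (auto intro!: sympI dest: rgraph_iso_sym simp: rooted_tree_def)
  show "transp (\<lambda>G H::nat rgraph. rooted_tree G \<and> rooted_tree H \<and> G \<simeq> H)"
    by (auto intro!: transpI dest: rgraph_iso_trans)
qed

definition remaining_verts :: "'a rgraph \<Rightarrow> 'a set \<Rightarrow> 'a set" where
  "remaining_verts G e = {v \<in> verts G. (root G, v) \<in> (adj (edges G - {e}))\<^sup>*}"

definition remaining_part :: "'a rgraph \<Rightarrow> 'a set \<Rightarrow> 'a rgraph" where
  "remaining_part G e =
     RGraph (remaining_verts G e) {f \<in> edges G - {e}. f \<subseteq> remaining_verts G e} (root G)"

definition graph_dist :: "'a rgraph \<Rightarrow> 'a \<Rightarrow> 'a \<Rightarrow> nat" where
  "graph_dist G u v = (LEAST n. (u, v) \<in> adj (edges G) ^^ n)"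

definition pruned_part :: "'a rgraph \<Rightarrow> 'a set \<Rightarrow> 'a rgraph" where
  "pruned_part G e =
     (let W = verts G - remaining_verts G e
      in RGraph W {f \<in> edges G - {e}. f \<subseteq> W} (arg_min (graph_dist G (root G)) (\<lambda>v. v \<in> W)))"

text \<open>\<open>graft s v t\<close> is $s \cup_v t$, built on the disjoint union of the vertex sets.\<close>

definition graft :: "'a rgraph \<Rightarrow> 'a \<Rightarrow> 'b rgraph \<Rightarrow> ('a + 'b) rgraph" where
  "graft s v t =
     RGraph (verts s <+> verts t)
       (insert {Inl v, Inr (root t)} ((`) Inl ` edges s \<union> (`) Inr ` edges t))
       (Inl (root s))"

text \<open>The following numbers do not depend on the representatives chosen by \<^const>\<open>rep_rtree\<close>.\<close>

definition tree_size :: "rtree \<Rightarrow> nat" where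
  "tree_size t = card (verts (rep_rtree t))"

definition tree_alpha :: "rtree \<Rightarrow> rtree \<Rightarrow> rtree \<Rightarrow> nat" where
  "tree_alpha t1 t2 t3 = card {e \<in> edges (rep_rtree t2).
     remaining_part (rep_rtree t2) e \<simeq> rep_rtree t3 \<and>
     pruned_part (rep_rtree t2) e \<simeq> rep_rtree t1}"

definition tree_beta :: "rtree \<Rightarrow> rtree \<Rightarrow> rtree \<Rightarrow> nat" where
  "tree_beta t1 t2 t3 = card {v \<in> verts (rep_rtree t3).
     rep_rtree t1 \<simeq> graft (rep_rtree t3) v (rep_rtree t2)}"

section \<open>The insertion-elimination algebra\<close>

datatype ie_basis = D | DPlus rtree | DMinus rtree

type_synonym ie_algebra = "ie_basis \<Rightarrow>\<^sub>0 complex"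

definition ie_scale :: "complex \<Rightarrow> ie_algebra \<Rightarrow> ie_algebra" where
  "ie_scale c = Poly_Mapping.map ((*) c)"

text \<open>All sums over \<^typ>\<open>rtree\<close> below have finitely many nonzero terms, as \<^const>\<open>Sum_any\<close>
  (which is \<open>0\<close> otherwise) requires.\<close>

definition ie_mixed :: "rtree \<Rightarrow> rtree \<Rightarrow> ie_algebra" where
  "ie_mixed s t =
     (if s = t then Poly_Mapping.single D 1
      else Sum_any (\<lambda>r. Poly_Mapping.single (DPlus r) (of_nat (tree_alpha s t r)))
         + Sum_any (\<lambda>r. Poly_Mapping.single (DMinus r) (of_nat (tree_beta s t r))))"

fun ie_basis_bracket :: "ie_basis \<Rightarrow> ie_basis \<Rightarrow> ie_algebra" where
  "ie_basis_bracket (DPlus s) (DPlus t) =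
     Sum_any (\<lambda>r. Poly_Mapping.single (DPlus r) (of_nat (tree_beta r s t) - of_nat (tree_beta r t s)))"
| "ie_basis_bracket (DMinus s) (DMinus t) =
     Sum_any (\<lambda>r. Poly_Mapping.single (DMinus r) (of_nat (tree_alpha t r s) - of_nat (tree_alpha s r t)))"
| "ie_basis_bracket (DMinus s) (DPlus t) = ie_mixed s t"
| "ie_basis_bracket (DPlus t) (DMinus s) = - ie_mixed s t"
| "ie_basis_bracket D (DMinus t) = Poly_Mapping.single (DMinus t) (- of_nat (tree_size t))"
| "ie_basis_bracket (DMinus t) D = Poly_Mapping.single (DMinus t) (of_nat (tree_size t))"
| "ie_basis_bracket D (DPlus t) = Poly_Mapping.single (DPlus t) (of_nat (tree_size t))"
| "ie_basis_bracket (DPlus t) D = Poly_Mapping.single (DPlus t) (- of_nat (tree_size t))"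
| "ie_basis_bracket D D = 0"

definition ie_bracket :: "ie_algebra \<Rightarrow> ie_algebra \<Rightarrow> ie_algebra" where
  "ie_bracket x y = (\<Sum>a\<in>Poly_Mapping.keys x. \<Sum>b\<in>Poly_Mapping.keys y.
     ie_scale (Poly_Mapping.lookup x a * Poly_Mapping.lookup y b) (ie_basis_bracket a b))"

section \<open>Derivations and first cohomology\<close>

definition derivations ::
  "('k::field \<Rightarrow> 'g \<Rightarrow> 'g) \<Rightarrow> ('g \<Rightarrow> 'g \<Rightarrow> 'g) \<Rightarrow> ('g::ab_group_add \<Rightarrow> 'g) set" where
  "derivations scale br = {\<delta>. Vector_Spaces.linear scale scale \<delta> \<and>
     (\<forall>x y. \<delta> (br x y) = br (\<delta> x) y + br x (\<delta> y))}"

definition inner_derivations :: "('g \<Rightarrow> 'g \<Rightarrow> 'g) \<Rightarrow> ('g \<Rightarrow> 'g) set" where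
  "inner_derivations br = {\<lambda>x. br x y | y. True}"

text \<open>Low-degree Chevalley-Eilenberg differentials for a Lie algebra with bracket \<open>br\<close>
  acting on a module by \<open>act\<close>.\<close>

definition CE_d0 :: "('g \<Rightarrow> 'm \<Rightarrow> 'm) \<Rightarrow> 'm \<Rightarrow> 'g \<Rightarrow> 'm" where
  "CE_d0 act m = (\<lambda>x. act x m)"

definition CE_d1 ::
  "('g \<Rightarrow> 'g \<Rightarrow> 'g) \<Rightarrow> ('g \<Rightarrow> 'm \<Rightarrow> 'm) \<Rightarrow> ('g \<Rightarrow> 'm::ab_group_add) \<Rightarrow> 'g \<Rightarrow> 'g \<Rightarrow> 'm" where
  "CE_d1 br act f = (\<lambda>x y. act x (f y) - act y (f x) - f (br x y))"

definition CE_Z1 ::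
  "('k::field \<Rightarrow> 'g \<Rightarrow> 'g) \<Rightarrow> ('g \<Rightarrow> 'g \<Rightarrow> 'g) \<Rightarrow> ('k \<Rightarrow> 'm \<Rightarrow> 'm) \<Rightarrow> ('g \<Rightarrow> 'm \<Rightarrow> 'm)
    \<Rightarrow> ('g::ab_group_add \<Rightarrow> 'm::ab_group_add) set" where
  "CE_Z1 scale br scale_m act =
     {f. Vector_Spaces.linear scale scale_m f \<and> (\<forall>x y. CE_d1 br act f x y = 0)}"

definition CE_B1 :: "('g \<Rightarrow> 'm \<Rightarrow> 'm) \<Rightarrow> ('g \<Rightarrow> 'm) set" where
  "CE_B1 act = range (CE_d0 act)"

definition quotient_space :: "'v::ab_group_add set \<Rightarrow> 'v set \<Rightarrow> 'v set set" where
  "quotient_space Z B = (\<lambda>f. f +o B) ` Z"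

text \<open>Cosets are added as sets; adding \<open>B\<close> in the scaling makes \<open>0\<close> times a coset equal to \<open>B\<close>.\<close>

definition quotient_scale ::
  "('k \<Rightarrow> 'v \<Rightarrow> 'v) \<Rightarrow> 'v::ab_group_add set \<Rightarrow> 'k \<Rightarrow> 'v set \<Rightarrow> 'v set" where
  "quotient_scale scale B c X = scale c ` X + B"

definition quotients_isomorphic ::
  "('k \<Rightarrow> 'v \<Rightarrow> 'v) \<Rightarrow> 'v::ab_group_add set \<Rightarrow> 'v set
    \<Rightarrow> ('k \<Rightarrow> 'w \<Rightarrow> 'w) \<Rightarrow> 'w::ab_group_add set \<Rightarrow> 'w set \<Rightarrow> bool" where
  "quotients_isomorphic scale Z B scale' Z' B' \<longleftrightarrow>
     (\<exists>\<phi>. bij_betw \<phi> (quotient_space Z B) (quotient_space Z' B') \<and>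
        (\<forall>X \<in> quotient_space Z B. \<forall>Y \<in> quotient_space Z B. \<phi> (X + Y) = \<phi> X + \<phi> Y) \<and>
        (\<forall>c. \<forall>X \<in> quotient_space Z B.
           \<phi> (quotient_scale scale B c X) = quotient_scale scale' B' c (\<phi> X)))"

definition pointwise_scale :: "('k \<Rightarrow> 'm \<Rightarrow> 'm) \<Rightarrow> 'k \<Rightarrow> ('g \<Rightarrow> 'm) \<Rightarrow> 'g \<Rightarrow> 'm" where
  "pointwise_scale scale c f = (\<lambda>x. scale c (f x))"

abbreviation "Der_ie \<equiv> derivations ie_scale ie_bracket"
abbreviation "Inn_ie \<equiv> inner_derivations ie_bracket"
abbreviation "Z1_ie \<equiv> CE_Z1 ie_scale ie_bracket ie_scale ie_bracket"
abbreviation "B1_ie \<equiv> CE_B1 ie_bracket"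
abbreviation "H1_ie \<equiv> quotient_space Z1_ie B1_ie"

end

theory Submission imports Defs begin

text \<open>The bracket relations come from an action, which makes the algebra a Lie algebra and its inner
derivations derivations.
A rooted tree \<open>s\<close> acts on functions of rooted trees by summing over all ways of attaching a copy of
\<open>s\<close> (\<open>attach\<close>), and over all cuts whose fallen part is \<open>s\<close> (\<open>prune\<close>); \<open>d\<close> multiplies by the
number of vertices. Comparing the places where two such operations happen gives the commutators
(\<open>attach_commutator\<close>, \<open>prune_commutator\<close>, \<open>prune_attach\<close>), and these are the defining relations of the
algebra: whatever happens at unrelated places cancels, and the nested configurations produce
the structure constants. The action is faithful, because its values at the one-vertex tree and at
the trees with a single root branch already determine all coefficients (\<open>rho_faithful\<close>).
So antisymmetry and the Jacobi identity are inherited from commutators of operators, and inner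
derivations are derivations.

Conversely, let \<open>\<delta>\<close> be a derivation. Since \<open>ad d\<close> is diagonal in the given basis, with
eigenvalue \<open>0\<close> only on \<open>d\<close>, subtracting an inner derivation achieves \<open>\<delta> d \<in> \<complex> d\<close>; subtracting a
multiple of \<open>ad d\<close> also kills the coefficient of \<open>D\<^sup>+\<close> of the one-vertex tree in its own image.
Such a \<open>\<delta>\<close> vanishes (\<open>normalised_derivation_eq_0\<close>). First \<open>\<delta> d = 0\<close> and \<open>\<delta>\<close> preserves the grading
by \<open>ad d\<close>. Then \<open>\<delta>\<close> is shown to kill all basis vectors of degree \<open>\<plusminus> n\<close> by induction on \<open>n\<close>: the
image \<open>y\<close> of such a vector is again homogeneous, and for every \<open>s\<close> with fewer than \<open>n\<close> vertices it
commutes with the vector of \<open>s\<close> of the opposite sign, because \<open>\<delta>\<close> kills that vector and the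
bracket, both being of smaller degree.

What makes this work is that a combination of trees with \<open>n \<ge> 2\<close> vertices, all of whose cuts sum to
zero, is zero (\<open>grafting_separates_trees\<close>): take a tree \<open>t\<close> of minimal root degree in it and cut a
branch \<open>s\<close> off its root, leaving \<open>r\<close>. Any other tree that can be cut into \<open>s\<close> and \<open>r\<close> arises from \<open>r\<close> by
attaching \<open>s\<close> away from the root, so it has smaller root degree. Hence the coefficient of
\<open>t\<close> cannot be cancelled. (In other words, trees form the free pre-Lie algebra on one generator, so that
its product spans everything beyond the generator.)

The combinatorics is done on graphs. A tree together with one of its edges is the same thing as two
disjoint trees and a vertex to join them at (\<open>cut_edge\<close>, \<open>remaining_part_join\<close>,
\<open>pruned_part_join\<close>), and all statements on cuts of cuts or cuts of grafted trees reduce to two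
identities for iterated joins, \<open>join_join_inner\<close> and \<open>join_join_swap\<close>.\<close>

section \<open>Trees as connected graphs in which every edge is a bridge\<close>

lemma rtrancl_map:
  assumes "(x, y) \<in> R\<^sup>*" "\<And>u v. (u, v) \<in> R \<Longrightarrow> (f u, f v) \<in> S\<^sup>*"
  shows "(f x, f y) \<in> S\<^sup>*"
  using assms(1) by induction (auto intro: rtrancl_trans assms(2))

lemma rtrancl_closed:
  assumes "(x, y) \<in> R\<^sup>*" "x \<in> C" "\<And>u v. u \<in> C \<Longrightarrow> (u, v) \<in> R \<Longrightarrow> v \<in> C"
  shows "y \<in> C"
  using assms(1,2) by induction (auto intro: assms(3))

lemma adj_iff [simp]: "(u, v) \<in> adj E \<longleftrightarrow> {u, v} \<in> E"
  by (simp add: adj_def)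

lemma adj_mono: "E \<subseteq> F \<Longrightarrow> (adj E)\<^sup>* \<subseteq> (adj F)\<^sup>*"
  by (intro rtrancl_mono) (auto simp: adj_def)

lemma adj_rtrancl_sym: "(u, v) \<in> (adj E)\<^sup>* \<Longrightarrow> (v, u) \<in> (adj E)\<^sup>*"
proof -
  have "sym (adj E)" by (auto simp: sym_def insert_commute)
  then show "(u, v) \<in> (adj E)\<^sup>* \<Longrightarrow> (v, u) \<in> (adj E)\<^sup>*"
    using sym_rtrancl symD by metis
qed

text \<open>Shortcutting at a repeated vertex: if the next vertex already occurs on the path, the path is
truncated there.\<close>

lemma adj_rtrancl_simple_path:
  assumes "(a, b) \<in> (adj E)\<^sup>*"
  shows "\<exists>vs. vs \<noteq> [] \<and> distinct vs \<and> hd vs = a \<and> last vs = b \<and> successively (\<lambda>u v. {u, v} \<in> E) vs"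
  using assms
proof induction
  case base
  show ?case by (intro exI[of _ "[a]"]) auto
next
  case (step y z)
  then obtain vs where vs: "vs \<noteq> []" "distinct vs" "hd vs = a" "last vs = y"
    "successively (\<lambda>u v. {u, v} \<in> E) vs" by blast
  show ?case
  proof (cases "z \<in> set vs")
    case True
    then obtain p q where pq: "vs = p @ z # q" by (meson split_list)
    show ?thesis
      by (rule exI[of _ "p @ [z]"]) (use vs pq in \<open>auto simp: successively_append_iff hd_append\<close>)
  next
    case False
    show ?thesis
      by (rule exI[of _ "vs @ [z]"]) (use vs False step in \<open>auto simp: successively_append_iff\<close>)
  qed
qed

text \<open>An edge whose endpoints are still connected after its removal closes a simple path to a cycle;
conversely every edge of a cycle can be bypassed along the rest of the cycle.\<close>

lemma no_graph_cycle_iff_bridges: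
  assumes "\<forall>e\<in>E. card e = 2"
  shows "(\<nexists>vs. graph_cycle E vs) \<longleftrightarrow> (\<forall>a b. {a, b} \<in> E \<longrightarrow> (a, b) \<notin> (adj (E - {{a, b}}))\<^sup>*)"
proof (intro iffI allI impI notI)
  fix a b
  assume nc: "\<nexists>vs. graph_cycle E vs" and ab: "{a, b} \<in> E" and p: "(a, b) \<in> (adj (E - {{a, b}}))\<^sup>*"
  have "a \<noteq> b" using assms ab by force
  obtain vs where vs: "vs \<noteq> []" "distinct vs" "hd vs = a" "last vs = b"
    "successively (\<lambda>u v. {u, v} \<in> E - {{a, b}}) vs" 
    using adj_rtrancl_simple_path[OF p] by blast
  have "length vs \<noteq> 1" using vs \<open>a \<noteq> b\<close> by (auto simp: length_Suc_conv)
  moreover have "length vs \<noteq> 2" using vs by (auto simp: length_Suc_conv eval_nat_numeral)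
  moreover have "length vs \<noteq> 0" using vs by auto
  ultimately have len: "length vs \<ge> 3" by linarith
  have "{vs ! i, vs ! (Suc i mod length vs)} \<in> E" if i: "i < length vs" for i
  proof (cases "Suc i = length vs")
    case True
    then have "vs ! i = b" using vs by (metis diff_Suc_1 last_conv_nth)
    moreover have "vs ! 0 = a" using vs by (metis hd_conv_nth)
    ultimately show ?thesis using True ab by (simp add: insert_commute)
  next
    case False
    then show ?thesis using i vs(5) by (auto simp: successively_conv_nth)
  qed
  then have "graph_cycle E vs" using len vs by (auto simp: graph_cycle_def)
  then show False using nc by blast
next
  assume br: "\<forall>a b. {a, b} \<in> E \<longrightarrow> (a, b) \<notin> (adj (E - {{a, b}}))\<^sup>*" and "\<exists>vs. graph_cycle E vs"
  then obtain vs where vs: "length vs \<ge> 3" "distinct vs"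
    and e: "\<And>i. i < length vs \<Longrightarrow> {vs ! i, vs ! (Suc i mod length vs)} \<in> E"
    by (auto simp: graph_cycle_def)
  let ?F = "E - {{vs ! 0, vs ! 1}}"
  have ne: "vs \<noteq> []" using vs by auto
  have *: "(vs ! 1, vs ! Suc k) \<in> (adj ?F)\<^sup>*" if "Suc k < length vs" for k
    using that
  proof (induction k)
    case (Suc k)
    have "{vs ! Suc k, vs ! Suc (Suc k)} \<in> E" using e[of "Suc k"] Suc.prems by simp
    moreover have "vs ! Suc (Suc k) \<noteq> vs ! 0" "vs ! Suc (Suc k) \<noteq> vs ! 1"
      using ne vs(2) Suc.prems by (simp_all add: nth_eq_iff_index_eq)
    then have "{vs ! Suc k, vs ! Suc (Suc k)} \<noteq> {vs ! 0, vs ! 1}" by auto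
    ultimately have "(vs ! Suc k, vs ! Suc (Suc k)) \<in> adj ?F" by simp
    then show ?case using Suc by (meson Suc_lessD rtrancl.rtrancl_into_rtrancl)
  qed simp
  define m where "m = length vs - 2"
  have m: "Suc (Suc m) = length vs" "m \<ge> 1" using vs by (auto simp: m_def)
  have "(vs ! 1, vs ! Suc m) \<in> (adj ?F)\<^sup>*" using *[of m] m by simp
  moreover have "{vs ! Suc m, vs ! 0} \<in> E" using e[of "Suc m"] m by simp
  moreover have "vs ! Suc m \<noteq> vs ! 0" "vs ! Suc m \<noteq> vs ! 1"
    using ne vs(2) m by (simp_all add: nth_eq_iff_index_eq)
  then have "{vs ! Suc m, vs ! 0} \<noteq> {vs ! 0, vs ! 1}" by auto
  ultimately have "(vs ! 1, vs ! 0) \<in> (adj ?F)\<^sup>*"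
    unfolding adj_def by (metis (no_types, lifting) CollectI Diff_iff case_prodI
        rtrancl.rtrancl_into_rtrancl singletonD)
  then have "(vs ! 0, vs ! 1) \<in> (adj ?F)\<^sup>*" by (rule adj_rtrancl_sym)
  moreover have "{vs ! 0, vs ! 1} \<in> E" using e[of 0] vs by force
  ultimately show False using br by blast
qed

text \<open>Bridges behave better than cycles when graphs are joined or split: paths can be projected,
whereas cycles would have to be followed.\<close>

lemma rooted_tree_iff_bridges:
  "rooted_tree G \<longleftrightarrow> finite (verts G) \<and> root G \<in> verts G \<and>
     (\<forall>e\<in>edges G. e \<subseteq> verts G \<and> card e = 2) \<and>
     (\<forall>v\<in>verts G. (root G, v) \<in> (adj (edges G))\<^sup>*) \<and>
     (\<forall>a b. {a, b} \<in> edges G \<longrightarrow> (a, b) \<notin> (adj (edges G - {{a, b}}))\<^sup>*)"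
proof -
  have conn: "(\<forall>u\<in>verts G. \<forall>v\<in>verts G. (u, v) \<in> (adj (edges G))\<^sup>*) \<longleftrightarrow>
      (\<forall>v\<in>verts G. (root G, v) \<in> (adj (edges G))\<^sup>*)" if "root G \<in> verts G"
    using that by (meson adj_rtrancl_sym rtrancl_trans)
  show ?thesis
    unfolding rooted_tree_def using no_graph_cycle_iff_bridges[of "edges G"] conn by blast
qed

lemma rooted_treeD:
  assumes "rooted_tree G"
  shows "finite (verts G)" "root G \<in> verts G" "\<And>e. e \<in> edges G \<Longrightarrow> e \<subseteq> verts G"
    "\<And>e. e \<in> edges G \<Longrightarrow> card e = 2" "finite (edges G)"
    "\<And>v. v \<in> verts G \<Longrightarrow> (root G, v) \<in> (adj (edges G))\<^sup>*"
    "\<And>a b. {a, b} \<in> edges G \<Longrightarrow> (a, b) \<notin> (adj (edges G - {{a, b}}))\<^sup>*"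
proof -
  note a = assms[unfolded rooted_tree_iff_bridges]
  show "finite (verts G)" "root G \<in> verts G" "\<And>e. e \<in> edges G \<Longrightarrow> e \<subseteq> verts G"
    "\<And>e. e \<in> edges G \<Longrightarrow> card e = 2"
    "\<And>v. v \<in> verts G \<Longrightarrow> (root G, v) \<in> (adj (edges G))\<^sup>*"
    "\<And>a b. {a, b} \<in> edges G \<Longrightarrow> (a, b) \<notin> (adj (edges G - {{a, b}}))\<^sup>*" using a by auto
  have "edges G \<subseteq> Pow (verts G)" using a by auto
  then show "finite (edges G)" using a finite_subset by auto
qed

section \<open>Cutting a tree at an edge\<close>

text \<open>The same construction as \<^const>\<open>graft\<close>, but inside one vertex type, for vertex sets that are
already disjoint. Cutting an edge undoes a join literally, not only up to isomorphism.\<close>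

definition join :: "'a rgraph \<Rightarrow> 'a \<Rightarrow> 'a rgraph \<Rightarrow> 'a rgraph" where
  "join A a B = RGraph (verts A \<union> verts B) (insert {a, root B} (edges A \<union> edges B)) (root A)"

definition joinable :: "'a rgraph \<Rightarrow> 'a \<Rightarrow> 'a rgraph \<Rightarrow> bool" where
  "joinable A a B \<longleftrightarrow> rooted_tree A \<and> rooted_tree B \<and> a \<in> verts A \<and> verts A \<inter> verts B = {}"

lemma join_sel [simp]:
  "verts (join A a B) = verts A \<union> verts B"
  "edges (join A a B) = insert {a, root B} (edges A \<union> edges B)"
  "root (join A a B) = root A"
  by (simp_all add: join_def)

text \<open>This identity and the next cover all relative positions of two joins: nested, and
independent.\<close>

lemma join_join_inner: "join (join A a B) b C = join A a (join B b C)"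
  by (auto simp: join_def)

lemma join_join_swap: "join (join A a B) b C = join (join A b C) a B"
  by (auto simp: join_def)

text \<open>Collapsing one of the two parts to the endpoint of the new edge maps a path that avoids a given
edge of the other part to a path in that part avoiding the same edge; so its edges remain bridges.\<close>

lemma rooted_tree_join:
  assumes "joinable A a B"
  shows "rooted_tree (join A a B)"
proof -
  have A: "rooted_tree A" and B: "rooted_tree B" and a: "a \<in> verts A"
    and dis: "verts A \<inter> verts B = {}"
    using assms by (auto simp: joinable_def)
  note tA = rooted_treeD[OF A] and tB = rooted_treeD[OF B]
  let ?E = "insert {a, root B} (edges A \<union> edges B)"
  have ab: "a \<noteq> root B" using a dis tB(2) by auto
  have conn: "(root A, v) \<in> (adj ?E)\<^sup>*" if v: "v \<in> verts A \<union> verts B" for v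
  proof (cases "v \<in> verts A")
    case True
    then show ?thesis using tA(6)[OF True] adj_mono[of "edges A" ?E] by blast
  next
    case False
    then have "(root B, v) \<in> (adj ?E)\<^sup>*" using v tB(6)[of v] adj_mono[of "edges B" ?E] by blast
    moreover have "(root A, a) \<in> (adj ?E)\<^sup>*" using tA(6)[OF a] adj_mono[of "edges A" ?E] by blast
    moreover have "(a, root B) \<in> adj ?E" by simp
    ultimately show ?thesis by (meson rtrancl.rtrancl_into_rtrancl rtrancl_trans)
  qed
  have bridge: False if e: "{x, y} \<in> ?E" and p: "(x, y) \<in> (adj (?E - {{x, y}}))\<^sup>*" for x y
  proof -
    consider "{x, y} = {a, root B}" | "{x, y} \<in> edges A" | "{x, y} \<in> edges B" using e by auto
    then show False
    proof cases
      case 1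
      have "(a, root B) \<in> (adj (?E - {{a, root B}}))\<^sup>*"
        using p 1 adj_rtrancl_sym by (fastforce simp: doubleton_eq_iff)
      then have "root B \<in> verts A"
        using a by (rule rtrancl_closed) (use dis tA(3) tB(3) in auto)
      then show False using dis tB(2) by auto
    next
      case 2
      let ?f = "\<lambda>z. if z \<in> verts A then z else a"
      have "(?f x, ?f y) \<in> (adj (edges A - {{x, y}}))\<^sup>*"
        using p
      proof (rule rtrancl_map)
        fix u v assume uv: "(u, v) \<in> adj (?E - {{x, y}})"
        then consider "{u, v} \<in> edges A - {{x, y}}" | "{u, v} \<in> edges B" | "{u, v} = {a, root B}" by auto
        then show "(?f u, ?f v) \<in> (adj (edges A - {{x, y}}))\<^sup>*"
        proof cases
          case 1
          then have "u \<in> verts A" "v \<in> verts A" using tA(3) by auto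
          then show ?thesis using 1 by (simp add: r_into_rtrancl)
        next
          case 2
          then have "u \<notin> verts A" "v \<notin> verts A" using tB(3) dis by auto
          then show ?thesis by simp
        next
          case 3
          have "root B \<notin> verts A" using tB(2) dis by auto
          then show ?thesis using 3 a by (auto simp: doubleton_eq_iff)
        qed
      qed
      moreover have "x \<in> verts A" "y \<in> verts A" using 2 tA(3) by auto
      ultimately show False using tA(7)[OF 2] by simp
    next
      case 3
      let ?f = "\<lambda>z. if z \<in> verts B then z else root B"
      have "(?f x, ?f y) \<in> (adj (edges B - {{x, y}}))\<^sup>*"
        using p
      proof (rule rtrancl_map)
        fix u v assume uv: "(u, v) \<in> adj (?E - {{x, y}})"
        then consider "{u, v} \<in> edges B - {{x, y}}" | "{u, v} \<in> edges A" | "{u, v} = {a, root B}" by auto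
        then show "(?f u, ?f v) \<in> (adj (edges B - {{x, y}}))\<^sup>*"
        proof cases
          case 1
          then have "u \<in> verts B" "v \<in> verts B" using tB(3) by auto
          then show ?thesis using 1 by (simp add: r_into_rtrancl)
        next
          case 2
          then have "u \<notin> verts B" "v \<notin> verts B" using tA(3) dis by auto
          then show ?thesis by simp
        next
          case 3
          have "a \<notin> verts B" using a dis by auto
          then show ?thesis using 3 by (auto simp: doubleton_eq_iff)
        qed
      qed
      moreover have "x \<in> verts B" "y \<in> verts B" using 3 tB(3) by auto
      ultimately show False using tB(7)[OF 3] by simp
    qed
  qed
  show ?thesis
    unfolding rooted_tree_iff_bridges join_sel
  proof (intro conjI allI impI notI)
    show "\<forall>e\<in>?E. e \<subseteq> verts A \<union> verts B \<and> card e = 2"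
      using tA(3,4) tB(2-4) a ab by (auto simp: subset_iff)
  qed (use conn bridge tA(1,2) tB(1) in blast)+
qed

lemma arg_min_strict:
  fixes f :: "'a \<Rightarrow> nat"
  assumes "P b" "\<And>x. P x \<Longrightarrow> x \<noteq> b \<Longrightarrow> f b < f x"
  shows "arg_min f P = b"
proof (rule ccontr)
  assume n: "arg_min f P \<noteq> b"
  have "P (arg_min f P)" using assms(1) by (rule arg_min_natI)
  then have "f b < f (arg_min f P)" using assms(2) n by blast
  moreover have "f (arg_min f P) \<le> f b" using assms(1) by (rule arg_min_nat_le)
  ultimately show False by simp
qed

lemma remaining_verts_join:
  assumes "joinable A a B"
  shows "remaining_verts (join A a B) {a, root B} = verts A"
proof -
  have A: "rooted_tree A" and B: "rooted_tree B" and a: "a \<in> verts A"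
    and dis: "verts A \<inter> verts B = {}"
    using assms by (auto simp: joinable_def)
  note tA = rooted_treeD[OF A] and tB = rooted_treeD[OF B]
  let ?F = "insert {a, root B} (edges A \<union> edges B) - {{a, root B}}"
  have sub: "edges A \<subseteq> ?F" using tA(3) tB(2) dis by fastforce
  have "v \<in> verts A" if "(root A, v) \<in> (adj ?F)\<^sup>*" for v
    using that tA(2) by (rule rtrancl_closed) (use dis tA(3) tB(3) in auto)
  moreover have "(root A, v) \<in> (adj ?F)\<^sup>*" if "v \<in> verts A" for v
    using tA(6)[OF that] adj_mono[OF sub] by blast
  ultimately show ?thesis by (auto simp: remaining_verts_def)
qed

lemma remaining_part_join:
  assumes "joinable A a B"
  shows "remaining_part (join A a B) {a, root B} = A"
proof -
  have A: "rooted_tree A" and B: "rooted_tree B" and a: "a \<in> verts A"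
    and dis: "verts A \<inter> verts B = {}"
    using assms by (auto simp: joinable_def)
  note tA = rooted_treeD[OF A] and tB = rooted_treeD[OF B]
  have "f \<notin> edges B" if "f \<subseteq> verts A" for f
    using that tB(3)[of f] tB(4)[of f] dis by (cases "f = {}") auto
  moreover have "{a, root B} \<notin> edges A" using tA(3) tB(2) dis by fastforce
  ultimately have "{f \<in> edges (join A a B) - {{a, root B}}. f \<subseteq> verts A} = edges A"
    using tA(3) by auto
  then show ?thesis
    by (simp add: remaining_part_def remaining_verts_join[OF assms])
qed

text \<open>Every path from the root into \<open>B\<close> enters through the root of \<open>B\<close>, which is therefore the unique
vertex of \<open>B\<close> at minimal distance.\<close>

lemma pruned_part_join:
  assumes "joinable A a B"
  shows "pruned_part (join A a B) {a, root B} = B"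
proof -
  have A: "rooted_tree A" and B: "rooted_tree B" and a: "a \<in> verts A"
    and dis: "verts A \<inter> verts B = {}"
    using assms by (auto simp: joinable_def)
  note tA = rooted_treeD[OF A] and tB = rooted_treeD[OF B]
  let ?G = "join A a B"
  let ?E = "edges ?G"
  have "f \<notin> edges A" if "f \<subseteq> verts B" for f
    using that tA(3)[of f] tA(4)[of f] dis by (cases "f = {}") auto
  moreover have "{a, root B} \<notin> edges B" using tB(3) a dis by fastforce
  ultimately have E: "{f \<in> ?E - {{a, root B}}. f \<subseteq> verts B} = edges B"
    using tB(3) a dis by auto
  have V: "verts ?G - verts A = verts B" using dis by auto
  have step: "\<exists>m\<le>n. (root A, root B) \<in> adj ?E ^^ m \<and> (v \<noteq> root B \<longrightarrow> m < n)"
    if "(root A, v) \<in> adj ?E ^^ n" "v \<in> verts B" for n v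
    using that
  proof (induction n arbitrary: v)
    case 0
    then show ?case using tA(2) dis by auto
  next
    case (Suc n)
    then obtain u where u: "(root A, u) \<in> adj ?E ^^ n" "{u, v} \<in> ?E" by auto
    show ?case
    proof (cases "u \<in> verts B")
      case True
      then show ?thesis using Suc.IH[OF u(1)] by (meson le_SucI le_imp_less_Suc)
    next
      case False
      then have "{u, v} = {a, root B}" using u(2) Suc.prems(2) tA(3) tB(3) dis by auto
      then have "v = root B" using Suc.prems(2) a dis by (auto simp: doubleton_eq_iff)
      then show ?thesis using Suc.prems(1) by blast
    qed
  qed
  have "arg_min (graph_dist ?G (root A)) (\<lambda>v. v \<in> verts B) = root B"
  proof (rule arg_min_strict)
    show "root B \<in> verts B" by (rule tB(2))
    fix v assume v: "v \<in> verts B" "v \<noteq> root B"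
    have "(root A, v) \<in> (adj ?E)\<^sup>*"
      using rooted_treeD(6)[OF rooted_tree_join[OF assms], of v] v by simp
    then obtain n where "(root A, v) \<in> adj ?E ^^ n" using rtrancl_power by metis
    then have "(root A, v) \<in> adj ?E ^^ graph_dist ?G (root A) v"
      unfolding graph_dist_def by (rule LeastI)
    then obtain m where m: "(root A, root B) \<in> adj ?E ^^ m" "m < graph_dist ?G (root A) v"
      using step v by blast
    have "graph_dist ?G (root A) (root B) \<le> m"
      unfolding graph_dist_def using m(1) by (rule Least_le)
    then show "graph_dist ?G (root A) (root B) < graph_dist ?G (root A) v" using m(2) by simp
  qed
  then show ?thesis
    using E V by (simp add: pruned_part_def remaining_verts_join[OF assms] Let_def)
qed

text \<open>The converse of \<open>remaining_part_join\<close> and \<open>pruned_part_join\<close>: every edge of a tree arises from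
a join. The two parts are the connected components of the root and of the far endpoint of the edge.\<close>

lemma cut_edge:
  assumes G: "rooted_tree G" and e: "e \<in> edges G"
  obtains a where "joinable (remaining_part G e) a (pruned_part G e)"
    "G = join (remaining_part G e) a (pruned_part G e)" "e = {a, root (pruned_part G e)}"
proof -
  note tG = rooted_treeD[OF G]
  let ?F = "edges G - {e}"
  define C where "C = (\<lambda>x. {v. (x, v) \<in> (adj ?F)\<^sup>*})"
  have Cstep: "v \<in> C x" if "u \<in> C x" "{u, v} \<in> ?F" for x u v
    using that unfolding C_def by (auto intro: rtrancl_into_rtrancl)
  have Cr: "x \<in> C x" for x by (simp add: C_def)
  have Csym: "v \<in> C y" if "v \<in> C x" "y \<in> C x" for v x y
    using that unfolding C_def by (auto intro: rtrancl_trans adj_rtrancl_sym)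
  have Csub: "C x \<subseteq> verts G" if "x \<in> verts G" for x
    unfolding C_def using rtrancl_closed[of x _ "adj ?F" "verts G"] that tG(3) by fastforce
  obtain x y where xy: "e = {x, y}" using tG(4)[OF e] by (auto simp: card_2_iff)
  have br: "(x, y) \<notin> (adj ?F)\<^sup>*" using tG(7)[of x y] e xy by simp
  have "x \<in> C (root G) \<or> y \<in> C (root G)"
  proof (rule ccontr)
    assume n: "\<not> ?thesis"
    have "x \<in> C (root G)"
    proof (rule rtrancl_closed[OF tG(6)[of x] Cr])
      show "x \<in> verts G" using tG(3)[OF e] xy by auto
      fix u v assume "u \<in> C (root G)" "(u, v) \<in> adj (edges G)"
      then show "v \<in> C (root G)" using Cstep n xy by (auto simp: doubleton_eq_iff)
    qed
    then show False using n by simp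
  qed
  then obtain a b where ab: "e = {a, b}" "a \<in> C (root G)" "(a, b) \<notin> (adj ?F)\<^sup>*"
    using xy br adj_rtrancl_sym[of y x] by (metis insert_commute)
  have bn: "b \<notin> C (root G)" using ab Csym[of b "root G" a] by (auto simp: C_def)
  have av: "a \<in> verts G" "b \<in> verts G" using ab tG(3)[OF e] by auto
  \<comment> \<open>the union of the two components is closed under all edges, including \<open>e\<close>\<close>
  have un: "verts G = C (root G) \<union> C b"
  proof
    show "verts G \<subseteq> C (root G) \<union> C b"
    proof
      fix v assume v: "v \<in> verts G"
      show "v \<in> C (root G) \<union> C b"
        using tG(6)[OF v]
      proof (rule rtrancl_closed)
        show "root G \<in> C (root G) \<union> C b" using Cr by blast
        fix u v assume uv: "u \<in> C (root G) \<union> C b" "(u, v) \<in> adj (edges G)"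
        show "v \<in> C (root G) \<union> C b"
        proof (cases "{u, v} = e")
          case True
          then show ?thesis using ab Cr by (auto simp: doubleton_eq_iff)
        next
          case False
          then show ?thesis using uv Cstep by auto
        qed
      qed
    qed
    show "C (root G) \<union> C b \<subseteq> verts G" using Csub av tG(2) by auto
  qed
  have dis: "C (root G) \<inter> C b = {}"
  proof (rule ccontr)
    assume "\<not> ?thesis"
    then obtain v where v: "v \<in> C (root G)" "v \<in> C b" by auto
    have "b \<in> C v" using Csym[OF Cr v(2)] .
    then have "b \<in> C (root G)" using v(1) unfolding C_def by (auto intro: rtrancl_trans)
    then show False using bn by simp
  qed
  define K where "K = (\<lambda>x. RGraph (C x) {f \<in> ?F. f \<subseteq> C x} x)"
  have K: "rooted_tree (K x)" if x: "x \<in> verts G" for x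
  proof -
    let ?K = "{f \<in> ?F. f \<subseteq> C x}"
    have conn: "(x, v) \<in> (adj ?K)\<^sup>*" if "v \<in> C x" for v
      using that[unfolded C_def, simplified]
    proof induction
      case (step y z)
      have "y \<in> C x" using step by (simp add: C_def)
      moreover have "z \<in> C x" using Cstep[OF \<open>y \<in> C x\<close>] step by simp
      ultimately have "(y, z) \<in> adj ?K" using step by simp
      then show ?case using step.IH by (rule rtrancl_into_rtrancl[rotated])
    qed simp
    have br: False if "{u, v} \<in> ?K" "(u, v) \<in> (adj (?K - {{u, v}}))\<^sup>*" for u v
    proof -
      have "(u, v) \<in> (adj (edges G - {{u, v}}))\<^sup>*"
        using that(2) adj_mono[of "?K - {{u, v}}" "edges G - {{u, v}}"] by blast
      then show False using tG(7) that(1) by blast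
    qed
    show ?thesis
      unfolding rooted_tree_iff_bridges K_def
      using conn br Cr tG(4) finite_subset[OF Csub[OF x] tG(1)] by auto
  qed
  have J: "joinable (K (root G)) a (K b)"
    using K[OF tG(2)] K[OF av(2)] ab(2) dis by (auto simp: joinable_def K_def)
  have inside: "f \<subseteq> C (root G) \<or> f \<subseteq> C b" if f: "f \<in> ?F" for f
  proof -
    obtain u v where uv: "f = {u, v}" using tG(4)[of f] f by (auto simp: card_2_iff)
    have "u \<in> verts G" using tG(3)[of f] f uv by auto
    then show ?thesis using un Cstep[of u _ v] f uv by auto
  qed
  have GJ: "G = join (K (root G)) a (K b)"
    using inside un e ab by (cases G) (auto simp: join_def K_def)
  have eJ: "e = {a, root (K b)}" using ab by (simp add: K_def)
  have "remaining_part G e = K (root G)" "pruned_part G e = K b"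
    using remaining_part_join[OF J] pruned_part_join[OF J] GJ eJ by metis+
  then show thesis using that[of a] J GJ eJ by simp
qed

section \<open>Relabelling of vertices and isomorphism classes\<close>

definition relabel :: "('a \<Rightarrow> 'b) \<Rightarrow> 'a rgraph \<Rightarrow> 'b rgraph" where
  "relabel f G = RGraph (f ` verts G) ((`) f ` edges G) (f (root G))"

lemma relabel_sel [simp]:
  "verts (relabel f G) = f ` verts G" "edges (relabel f G) = (`) f ` edges G" "root (relabel f G) = f (root G)"
  by (simp_all add: relabel_def)

lemma relabel_relabel [simp]: "relabel f (relabel g G) = relabel (f \<circ> g) G"
  by (simp add: relabel_def image_image image_comp)

lemma relabel_id [simp]: "relabel id G = G" "relabel (\<lambda>x. x) G = G"
  by (cases G; simp add: relabel_def)+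

lemma relabel_join: "relabel f (join A a B) = join (relabel f A) (f a) (relabel f B)"
  by (simp add: relabel_def join_def image_Un)

text \<open>Bridges are pulled back along the inverse of the relabelling.\<close>

lemma rooted_tree_relabel:
  assumes G: "rooted_tree G" and f: "inj_on f (verts G)"
  shows "rooted_tree (relabel f G)"
proof -
  note tG = rooted_treeD[OF G]
  let ?g = "inv_into (verts G) f"
  have conn: "(f (root G), f v) \<in> (adj ((`) f ` edges G))\<^sup>*" if "v \<in> verts G" for v
    using tG(6)[OF that]
  proof (rule rtrancl_map)
    fix u v assume "(u, v) \<in> adj (edges G)"
    then have "f ` {u, v} \<in> (`) f ` edges G" unfolding adj_iff by (rule imageI)
    then show "(f u, f v) \<in> (adj ((`) f ` edges G))\<^sup>*" by (intro r_into_rtrancl) simp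
  qed
  have bridge: False
    if e: "{x, y} \<in> (`) f ` edges G" and p: "(x, y) \<in> (adj ((`) f ` edges G - {{x, y}}))\<^sup>*" for x y
  proof -
    obtain e where e: "e \<in> edges G" "f ` e = {x, y}" using e by auto
    have eG: "e \<subseteq> verts G" using tG(3) e by auto
    have xy: "?g x \<in> e" "?g y \<in> e"
      using e(2) eG f by (metis imageE inv_into_f_f insertCI subsetD)+
    have "card {x, y} = 2" using e tG(4)[OF e(1)] card_image[of f e] inj_on_subset[OF f eG] by simp
    then have "x \<noteq> y" by auto
    then have "?g x \<noteq> ?g y" using e(2) eG
      by (metis f_inv_into_f image_mono insertCI subsetD)
    then have exy: "e = {?g x, ?g y}" using xy tG(4)[OF e(1)] by (auto simp: card_2_iff)
    have "(?g x, ?g y) \<in> (adj (edges G - {{?g x, ?g y}}))\<^sup>*"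
      using p
    proof (rule rtrancl_map)
      fix u v assume "(u, v) \<in> adj ((`) f ` edges G - {{x, y}})"
      then have uv: "{u, v} \<in> (`) f ` edges G" "{u, v} \<noteq> f ` e" using e(2) by simp_all
      then obtain e' where e': "e' \<in> edges G" "f ` e' = {u, v}" by (metis imageE)
      then have "e' \<noteq> e" using uv(2) by blast
      have "?g ` f ` e' = e'" using f tG(3)[OF e'(1)] by (simp add: inv_into_image_cancel)
      then have "{?g u, ?g v} = e'" using e'(2) by simp
      then show "(?g u, ?g v) \<in> (adj (edges G - {{?g x, ?g y}}))\<^sup>*"
        using e'(1) \<open>e' \<noteq> e\<close> exy by (intro r_into_rtrancl) simp
    qed
    then show False using tG(7)[of "?g x" "?g y"] e(1) exy by simp
  qed
  have card: "card (f ` e) = 2" if "e \<in> edges G" for e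
    using card_image[of f e] inj_on_subset[OF f tG(3)[OF that]] tG(4)[OF that] by simp
  show ?thesis
    unfolding rooted_tree_iff_bridges relabel_sel
  proof (intro conjI allI impI notI)
    show "\<forall>e\<in>(`) f ` edges G. e \<subseteq> f ` verts G \<and> card e = 2"
      using tG(3) card by blast
  qed (use conn bridge tG(1,2) in blast)+
qed

lemma rgraph_iso_relabel:
  assumes G: "rooted_tree G" and f: "inj_on f (verts G)"
  shows "G \<simeq> relabel f G"
  unfolding rgraph_iso_def
proof (intro exI[of _ f] conjI ballI)
  show "bij_betw f (verts G) (verts (relabel f G))" using f by (simp add: bij_betw_def)
  fix u v assume uv: "u \<in> verts G" "v \<in> verts G"
  have "{u, v} = e" if "e \<in> edges G" "f ` e = {f u, f v}" for e
    using inj_on_image_eq_iff[OF f, of "{u, v}" e] that uv rooted_treeD(3)[OF G] by auto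
  then show "({u, v} \<in> edges G) = ({f u, f v} \<in> edges (relabel f G))" by (auto simp: image_iff)
qed simp

lemma rgraph_isoE:
  assumes G: "rooted_tree G" and H: "rooted_tree H" and iso: "G \<simeq> H"
  obtains f where "inj_on f (verts G)" "H = relabel f G"
proof -
  obtain f where f: "bij_betw f (verts G) (verts H)" "f (root G) = root H"
    "\<And>u v. u \<in> verts G \<Longrightarrow> v \<in> verts G \<Longrightarrow> {u, v} \<in> edges G \<longleftrightarrow> {f u, f v} \<in> edges H"
    using iso unfolding rgraph_iso_def by blast
  have "edges H = (`) f ` edges G"
  proof
    show "edges H \<subseteq> (`) f ` edges G"
    proof
      fix e assume e: "e \<in> edges H"
      then obtain x y where xy: "e = {x, y}" using rooted_treeD(4)[OF H] by (metis card_2_iff)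
      then have "x \<in> f ` verts G" "y \<in> f ` verts G"
        using rooted_treeD(3)[OF H e] f(1) by (auto simp: bij_betw_def)
      then obtain u v where "u \<in> verts G" "v \<in> verts G" "x = f u" "y = f v" by auto
      then show "e \<in> (`) f ` edges G" using f(3)[of u v] e xy by (intro image_eqI[of _ _ "{u, v}"]) auto
    qed
    show "(`) f ` edges G \<subseteq> edges H"
    proof
      fix e assume "e \<in> (`) f ` edges G"
      then obtain e' where e': "e' \<in> edges G" "e = f ` e'" by auto
      then obtain u v where uv: "e' = {u, v}" using rooted_treeD(4)[OF G] by (metis card_2_iff)
      then show "e \<in> edges H" using f(3)[of u v] e' rooted_treeD(3)[OF G e'(1)] by auto
    qed
  qed
  then have "H = relabel f G" using f(1,2) by (cases H) (auto simp: relabel_def bij_betw_def)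
  then show thesis using that f(1) by (auto simp: bij_betw_def)
qed

lemma joinable_relabel:
  assumes "joinable A a B" "inj_on f (verts A \<union> verts B)"
  shows "joinable (relabel f A) (f a) (relabel f B)"
  using assms by (auto simp: joinable_def inj_on_Un intro!: rooted_tree_relabel)

lemma cut_relabel:
  assumes G: "rooted_tree G" and f: "inj_on f (verts G)" and e: "e \<in> edges G"
  shows "remaining_part (relabel f G) (f ` e) = relabel f (remaining_part G e)"
    "pruned_part (relabel f G) (f ` e) = relabel f (pruned_part G e)"
proof -
  obtain a where a: "joinable (remaining_part G e) a (pruned_part G e)"
    "G = join (remaining_part G e) a (pruned_part G e)" "e = {a, root (pruned_part G e)}"
    using cut_edge[OF G e] .
  let ?A = "remaining_part G e" and ?B = "pruned_part G e"
  have J: "joinable (relabel f ?A) (f a) (relabel f ?B)"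
    by (rule joinable_relabel[OF a(1)]) (use a(2) f join_sel(1) in metis)
  have i: "relabel f G = join (relabel f ?A) (f a) (relabel f ?B)" using a(2) relabel_join by metis
  have e': "f ` e = {f a, root (relabel f ?B)}" using arg_cong[OF a(3), of "(`) f"] by simp
  show "remaining_part (relabel f G) (f ` e) = relabel f ?A"
    unfolding i e' by (rule remaining_part_join[OF J])
  show "pruned_part (relabel f G) (f ` e) = relabel f ?B"
    unfolding i e' by (rule pruned_part_join[OF J])
qed

text \<open>Reduces grafting on disjoint sums to joins, and thereby its iterates to
\<open>join_join_inner\<close> and \<open>join_join_swap\<close>.\<close>

lemma graft_eq_join: "graft s v t = join (relabel Inl s) (Inl v) (relabel Inr t)"
  by (auto simp: graft_def join_def Plus_def)

lemma graft_sel [simp]: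
  "verts (graft s v t) = Inl ` verts s \<union> Inr ` verts t" 
  by (simp_all add: graft_eq_join)

lemma joinable_graft:
  "rooted_tree s \<Longrightarrow> rooted_tree t \<Longrightarrow> v \<in> verts s \<Longrightarrow> joinable (relabel Inl s) (Inl v) (relabel Inr t)"
  by (auto simp: joinable_def intro!: rooted_tree_relabel)

lemma rooted_tree_graft:
  "rooted_tree s \<Longrightarrow> rooted_tree t \<Longrightarrow> v \<in> verts s \<Longrightarrow> rooted_tree (graft s v t)"
  unfolding graft_eq_join by (intro rooted_tree_join joinable_graft)

lemma graft_relabel: "graft (relabel f s) (f v) (relabel g t) = relabel (map_sum f g) (graft s v t)"
  by (simp add: graft_eq_join relabel_join comp_def)

lemma joinableD:
  assumes "joinable A a B"
  shows "rooted_tree A" "rooted_tree B" "a \<in> verts A" "verts A \<inter> verts B = {}"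
  using assms by (auto simp: joinable_def)

lemma rooted_tree_rep: "rooted_tree (rep_rtree t)"
  using Quotient3_rep_reflp[OF Quotient3_rtree] by blast

lemma rep_iso_imp_eq: "rep_rtree s \<simeq> rep_rtree t \<Longrightarrow> s = t"
  using Quotient3_rel_rep[OF Quotient3_rtree] rooted_tree_rep by blast

lemma ex_rep_iso:
  assumes G: "rooted_tree G"
  shows "\<exists>t. G \<simeq> rep_rtree t"
proof -
  obtain f :: "'a \<Rightarrow> nat" where f: "inj_on f (verts G)"
    using finite_imp_inj_to_nat_seg[OF rooted_treeD(1)[OF G]] by blast
  have t: "rooted_tree (relabel f G)" by (rule rooted_tree_relabel[OF G f])
  then have "rep_rtree (abs_rtree (relabel f G)) \<simeq> relabel f G"
    using rep_abs_rsp_left[OF Quotient3_rtree, of "relabel f G" "relabel f G"] rgraph_iso_refl by blast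
  then have "relabel f G \<simeq> rep_rtree (abs_rtree (relabel f G))"
    using rgraph_iso_sym rooted_treeD(2)[OF rooted_tree_rep] by blast
  then show ?thesis using rgraph_iso_trans[OF rgraph_iso_relabel[OF G f]] by blast
qed

definition tree_of :: "'a rgraph \<Rightarrow> rtree" where
  "tree_of G = (SOME t. G \<simeq> rep_rtree t)"

lemma iso_rep_tree_of: "rooted_tree G \<Longrightarrow> G \<simeq> rep_rtree (tree_of G)"
  unfolding tree_of_def by (rule someI_ex[OF ex_rep_iso])

lemma tree_of_eqI:
  assumes "rooted_tree G" "G \<simeq> rep_rtree t"
  shows "tree_of G = t"
  by (rule rep_iso_imp_eq)
    (meson assms iso_rep_tree_of rgraph_iso_sym rgraph_iso_trans rooted_treeD(2))

lemma tree_of_eq_rep_iff: "rooted_tree G \<Longrightarrow> tree_of G = t \<longleftrightarrow> G \<simeq> rep_rtree t"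
  using tree_of_eqI iso_rep_tree_of by blast

lemma tree_of_rep [simp]: "tree_of (rep_rtree t) = t"
  by (rule tree_of_eqI[OF rooted_tree_rep rgraph_iso_refl])

lemma tree_of_relabel [simp]:
  assumes "rooted_tree G" "inj_on f (verts G)"
  shows "tree_of (relabel f G) = tree_of G"
  by (rule tree_of_eqI[OF assms(1), symmetric])
    (rule rgraph_iso_trans[OF rgraph_iso_relabel[OF assms] iso_rep_tree_of[OF rooted_tree_relabel[OF assms]]])

lemma rep_tree_of_E:
  assumes "rooted_tree G"
  obtains f where "inj_on f (verts G)" "rep_rtree (tree_of G) = relabel f G"
  using rgraph_isoE[OF assms rooted_tree_rep iso_rep_tree_of[OF assms]] .

lemma tree_of_graft_rep_tree_of [simp]:
  assumes "rooted_tree G" "rooted_tree T" "v \<in> verts G"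
  shows "tree_of (graft G v (rep_rtree (tree_of T))) = tree_of (graft G v T)"
proof -
  obtain f where f: "inj_on f (verts T)" "rep_rtree (tree_of T) = relabel f T"
    using rep_tree_of_E[OF assms(2)] .
  have "graft G v (rep_rtree (tree_of T)) = relabel (map_sum id f) (graft G v T)"
    using graft_relabel[of id G v f T] f(2) by simp
  moreover have "inj_on (map_sum id f) (verts (graft G v T))"
    using f(1) by (auto intro!: inj_onI dest: inj_onD)
  ultimately show ?thesis using rooted_tree_graft[OF assms] by simp
qed

text \<open>Forgetting the tags of the disjoint sum is injective on disjoint vertex sets.\<close>

lemma tree_of_join_eq_graft:
  assumes "joinable A a B"
  shows "tree_of (join A a B) = tree_of (graft A a B)"
proof -
  have "relabel (case_sum id id) (graft A a B) = join A a B"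
    by (simp add: graft_eq_join relabel_join comp_def)
  moreover have "inj_on (case_sum id id) (verts (graft A a B))"
    using assms by (auto simp: joinable_def intro!: inj_onI)
  ultimately show ?thesis
    using tree_of_relabel[of "graft A a B" "case_sum id id"] rooted_tree_graft joinableD(1-3)[OF assms] by metis
qed

lemma graft_graft_inner:
  assumes "rooted_tree u" "rooted_tree s" "rooted_tree t" "v \<in> verts u" "w \<in> verts s"
  shows "tree_of (graft (graft u v s) (Inr w) t) = tree_of (graft u v (graft s w t))"
proof -
  let ?f = "case_sum (case_sum Inl (Inr \<circ> Inl)) (Inr \<circ> Inr)"
  have "relabel ?f (graft (graft u v s) (Inr w) t) = graft u v (graft s w t)"
    by (simp add: graft_eq_join relabel_join join_join_inner comp_def)
  moreover have "inj ?f" by (auto simp: inj_def split: sum.splits)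
  ultimately show ?thesis
    using tree_of_relabel[of "graft (graft u v s) (Inr w) t" ?f] assms
    by (metis inj_on_subset subset_UNIV rooted_tree_graft graft_sel(1) UnI2 imageI)
qed

lemma graft_graft_swap:
  assumes "rooted_tree u" "rooted_tree s" "rooted_tree t" "v \<in> verts u" "w \<in> verts u"
  shows "tree_of (graft (graft u v s) (Inl w) t) = tree_of (graft (graft u w t) (Inl v) s)"
proof -
  let ?f = "case_sum (case_sum (Inl \<circ> Inl) Inr) (Inl \<circ> Inr)"
  have "relabel ?f (graft (graft u v s) (Inl w) t) = graft (graft u w t) (Inl v) s"
    by (simp add: graft_eq_join relabel_join join_join_swap[of _ "Inl (Inl v)"] comp_def)
  moreover have "inj ?f" by (auto simp: inj_def split: sum.splits)
  ultimately show ?thesis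
    using tree_of_relabel[of "graft (graft u v s) (Inl w) t" ?f] assms
    by (metis inj_on_subset subset_UNIV rooted_tree_graft graft_sel(1) UnI1 imageI)
qed

section \<open>Attaching and pruning as operators on functions of trees\<close>

lemma tree_of_eq_iff_iso: 
  assumes "rooted_tree G" "rooted_tree H"
  shows "tree_of G = tree_of H \<longleftrightarrow> G \<simeq> H"
  by (metis assms tree_of_eqI tree_of_eq_rep_iff iso_rep_tree_of rgraph_iso_trans rgraph_iso_sym rooted_treeD(2))

lemma cut_tree:
  assumes "rooted_tree G" "e \<in> edges G"
  shows "rooted_tree (remaining_part G e)" "rooted_tree (pruned_part G e)"
  using cut_edge[OF assms] joinableD by metis+

definition kronecker :: "rtree \<Rightarrow> rtree \<Rightarrow> complex" where
  "kronecker s t = (if s = t then 1 else 0)"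

text \<open>Sorts a sum over vertices or edges by the tree it depends on; this is where counts such as
\<^const>\<open>tree_alpha\<close> and \<^const>\<open>tree_beta\<close> come from.\<close>

lemma sum_fibre:
  assumes "finite X"
  shows "(\<Sum>x\<in>X. h x * f (g x)) = Sum_any (\<lambda>w. (\<Sum>x\<in>X. h x * kronecker w (g x)) * f w)"
proof -
  have "Sum_any (\<lambda>w. (\<Sum>x\<in>X. h x * kronecker w (g x)) * f w) = (\<Sum>w\<in>g ` X. (\<Sum>x\<in>X. h x * kronecker w (g x)) * f w)"
  proof (rule Sum_any.expand_superset)
    have "(\<Sum>x\<in>X. h x * kronecker w (g x)) = 0" if "w \<notin> g ` X" for w
      using that by (intro sum.neutral) (auto simp: kronecker_def)
    then show "{w. (\<Sum>x\<in>X. h x * kronecker w (g x)) * f w \<noteq> 0} \<subseteq> g ` X" by force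
  qed (use assms in simp)
  also have "\<dots> = (\<Sum>x\<in>X. \<Sum>w\<in>g ` X. h x * kronecker w (g x) * f w)"
    unfolding sum_distrib_right by (rule sum.swap)
  also have "\<dots> = (\<Sum>x\<in>X. h x * f (g x))"
  proof (intro sum.cong refl)
    fix x assume x: "x \<in> X"
    have "(\<Sum>w\<in>g ` X. h x * kronecker w (g x) * f w) = (\<Sum>w\<in>g ` X. if w = g x then h x * f (g x) else 0)"
      by (intro sum.cong refl) (auto simp: kronecker_def)
    then show "(\<Sum>w\<in>g ` X. h x * kronecker w (g x) * f w) = h x * f (g x)"
      using assms x by (simp add: sum.delta)
  qed
  finally show ?thesis ..
qed

lemma tree_of_graft_relabel:
  assumes G: "rooted_tree G" and T: "rooted_tree T" and v: "v \<in> verts G" and h: "inj_on h (verts G)"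
  shows "tree_of (graft (relabel h G) (h v) T) = tree_of (graft G v T)"
proof -
  have "graft (relabel h G) (h v) T = relabel (map_sum h id) (graft G v T)"
    using graft_relabel[of h G v id] by simp
  moreover have "inj_on (map_sum h id) (verts (graft G v T))"
    using h(1) by (auto intro!: inj_onI dest: inj_onD)
  ultimately show ?thesis using rooted_tree_graft[OF G T v] by simp
qed

text \<open>The operators act on functions rather than on formal sums of trees, so that no linear extension
is needed and every sum is finite. Taking an arbitrary graph as the argument makes it possible to evaluate
them on explicitly grafted or cut graphs.\<close>

definition attach :: "rtree \<Rightarrow> (rtree \<Rightarrow> complex) \<Rightarrow> 'a rgraph \<Rightarrow> complex" where
  "attach s f G = (\<Sum>v\<in>verts G. f (tree_of (graft G v (rep_rtree s))))"

definition prune :: "rtree \<Rightarrow> (rtree \<Rightarrow> complex) \<Rightarrow> 'a rgraph \<Rightarrow> complex" where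
  "prune s f G = (\<Sum>e\<in>edges G. kronecker s (tree_of (pruned_part G e)) * f (tree_of (remaining_part G e)))"

lemma attach_rep_tree_of [simp]:
  assumes G: "rooted_tree G"
  shows "attach s f (rep_rtree (tree_of G)) = attach s f G"
proof -
  obtain h where h: "inj_on h (verts G)" "rep_rtree (tree_of G) = relabel h G"
    using rep_tree_of_E[OF G] .
  have "tree_of (graft (relabel h G) (h v) (rep_rtree s)) = tree_of (graft G v (rep_rtree s))"
    if v: "v \<in> verts G" for v
    by (rule tree_of_graft_relabel[OF G rooted_tree_rep v h(1)])
  then show ?thesis
    by (simp add: attach_def h sum.reindex)
qed

lemma prune_rep_tree_of [simp]:
  assumes G: "rooted_tree G"
  shows "prune s f (rep_rtree (tree_of G)) = prune s f G"
proof -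
  obtain h where h: "inj_on h (verts G)" "rep_rtree (tree_of G) = relabel h G"
    using rep_tree_of_E[OF G] .
  have inj: "inj_on ((`) h) (edges G)"
    using inj_on_image_eq_iff[OF h(1)] rooted_treeD(3)[OF G] by (auto intro!: inj_onI)
  have "tree_of (pruned_part (relabel h G) (h ` e)) = tree_of (pruned_part G e) \<and>
    tree_of (remaining_part (relabel h G) (h ` e)) = tree_of (remaining_part G e)" if e: "e \<in> edges G" for e
  proof -
    obtain a where a: "joinable (remaining_part G e) a (pruned_part G e)"
      "G = join (remaining_part G e) a (pruned_part G e)"
      using cut_edge[OF G e] .
    have "verts G = verts (remaining_part G e) \<union> verts (pruned_part G e)"
      using a(2) join_sel(1) by metis
    then have "inj_on h (verts (remaining_part G e))" "inj_on h (verts (pruned_part G e))"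
      using h(1) by (auto intro: inj_on_subset)
    then show ?thesis using cut_relabel[OF G h(1) e] cut_tree[OF G e] by simp
  qed
  then show ?thesis
    by (simp add: prune_def h sum.reindex[OF inj])
qed

lemma of_nat_card_kronecker:
  assumes "finite X"
  shows "of_nat (card {x \<in> X. P x}) = (\<Sum>x\<in>X. if P x then 1 else 0 :: complex)"
  using assms by (simp add: sum.If_cases Collect_conj_eq)

text \<open>The structure constants are themselves values of the operators, at Kronecker functions.\<close>

lemma tree_beta_eq: "of_nat (tree_beta r s t) = attach s (kronecker r) (rep_rtree t)"
proof -
  have "{v \<in> verts (rep_rtree t). rep_rtree r \<simeq> graft (rep_rtree t) v (rep_rtree s)} =
    {v \<in> verts (rep_rtree t). r = tree_of (graft (rep_rtree t) v (rep_rtree s))}"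
    using tree_of_eq_iff_iso[OF rooted_tree_rep rooted_tree_graft[OF rooted_tree_rep rooted_tree_rep]]
    by auto
  then show ?thesis
    unfolding tree_beta_def attach_def kronecker_def
    by (simp only: of_nat_card_kronecker[OF rooted_treeD(1)[OF rooted_tree_rep]])
qed

lemma tree_alpha_eq: "of_nat (tree_alpha s t r) = prune s (kronecker r) (rep_rtree t)"
proof -
  let ?G = "rep_rtree t"
  have "{e \<in> edges ?G. remaining_part ?G e \<simeq> rep_rtree r \<and> pruned_part ?G e \<simeq> rep_rtree s} =
    {e \<in> edges ?G. s = tree_of (pruned_part ?G e) \<and> r = tree_of (remaining_part ?G e)}"
  proof -
    have "remaining_part ?G e \<simeq> rep_rtree r \<longleftrightarrow> r = tree_of (remaining_part ?G e)"
      "pruned_part ?G e \<simeq> rep_rtree s \<longleftrightarrow> s = tree_of (pruned_part ?G e)" if "e \<in> edges ?G" for e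
      using tree_of_eq_rep_iff cut_tree[OF rooted_tree_rep that] by metis+
    then show ?thesis by blast
  qed
  then show ?thesis
    unfolding tree_alpha_def prune_def kronecker_def
    by (simp only: of_nat_card_kronecker[OF rooted_treeD(5)[OF rooted_tree_rep]])
      (intro sum.cong refl, simp)
qed

text \<open>The second tree is attached either at an old vertex, or at a vertex of the copy of \<open>s\<close> just
attached; in the second case it can be attached to \<open>s\<close> beforehand.\<close>

lemma attach_attach:
  assumes G: "rooted_tree G"
  shows "attach s (\<lambda>w. attach t f (rep_rtree w)) G =
    (\<Sum>v\<in>verts G. \<Sum>w\<in>verts G. f (tree_of (graft (graft G v (rep_rtree s)) (Inl w) (rep_rtree t)))) +
    Sum_any (\<lambda>r. of_nat (tree_beta r t s) * attach r f G)"
proof -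
  let ?S = "rep_rtree s" and ?T = "rep_rtree t"
  have S: "rooted_tree ?S" and T: "rooted_tree ?T" by (rule rooted_tree_rep)+
  have "attach s (\<lambda>w. attach t f (rep_rtree w)) G =
      (\<Sum>v\<in>verts G. \<Sum>w\<in>verts (graft G v ?S). f (tree_of (graft (graft G v ?S) w ?T)))"
    unfolding attach_def[of s]
    by (intro sum.cong refl, subst attach_rep_tree_of) (auto simp: rooted_tree_graft G S attach_def simp del: graft_sel)
  also have "\<dots> = (\<Sum>v\<in>verts G. (\<Sum>w\<in>verts G. f (tree_of (graft (graft G v ?S) (Inl w) ?T))) +
      (\<Sum>w\<in>verts ?S. f (tree_of (graft (graft G v ?S) (Inr w) ?T))))"
    by (intro sum.cong refl, simp, subst sum.union_disjoint)
      (auto simp: rooted_treeD(1) G S sum.reindex)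
  also have "\<dots> = (\<Sum>v\<in>verts G. \<Sum>w\<in>verts G. f (tree_of (graft (graft G v ?S) (Inl w) ?T))) +
      (\<Sum>v\<in>verts G. \<Sum>w\<in>verts ?S. f (tree_of (graft (graft G v ?S) (Inr w) ?T)))"
    by (rule sum.distrib)
  also have "(\<Sum>v\<in>verts G. \<Sum>w\<in>verts ?S. f (tree_of (graft (graft G v ?S) (Inr w) ?T))) =
      (\<Sum>w\<in>verts ?S. 1 * attach (tree_of (graft ?S w ?T)) f G)"
    unfolding attach_def
    by (subst sum.swap, intro sum.cong refl)
      (simp, intro sum.cong refl, simp add: graft_graft_inner G S T rooted_tree_graft)
  also have "\<dots> = Sum_any (\<lambda>r. of_nat (tree_beta r t s) * attach r f G)"
    by (subst sum_fibre[OF rooted_treeD(1)[OF S]]) (simp add: tree_beta_eq attach_def)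
  finally show ?thesis .
qed

text \<open>The contributions with both trees attached at old vertices are symmetric in \<open>s\<close> and \<open>t\<close>.\<close>

lemma attach_commutator:
  assumes G: "rooted_tree G"
  shows "attach s (\<lambda>w. attach t f (rep_rtree w)) G - attach t (\<lambda>w. attach s f (rep_rtree w)) G =
    Sum_any (\<lambda>r. of_nat (tree_beta r t s) * attach r f G) - Sum_any (\<lambda>r. of_nat (tree_beta r s t) * attach r f G)"
proof -
  have "(\<Sum>v\<in>verts G. \<Sum>w\<in>verts G. f (tree_of (graft (graft G v (rep_rtree s)) (Inl w) (rep_rtree t)))) =
      (\<Sum>v\<in>verts G. \<Sum>w\<in>verts G. f (tree_of (graft (graft G w (rep_rtree t)) (Inl v) (rep_rtree s))))"
    by (intro sum.cong refl arg_cong[of _ _ f] graft_graft_swap G rooted_tree_rep)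
  also have "\<dots> = (\<Sum>v\<in>verts G. \<Sum>w\<in>verts G. f (tree_of (graft (graft G v (rep_rtree t)) (Inl w) (rep_rtree s))))"
    by (rule sum.swap)
  finally show ?thesis unfolding attach_attach[OF G] by simp
qed

lemma cut_graft_new_edge:
  assumes u: "rooted_tree u" and T: "rooted_tree T" and v: "v \<in> verts u"
  shows "remaining_part (graft u v T) {Inl v, Inr (root T)} = relabel Inl u"
    "pruned_part (graft u v T) {Inl v, Inr (root T)} = relabel Inr T"
  using remaining_part_join[OF joinable_graft[OF u T v]] pruned_part_join[OF joinable_graft[OF u T v]]
  by (simp_all add: graft_eq_join)

text \<open>Cutting inside the grafted copy is the same as grafting the remaining part of that copy.\<close>

lemma cut_graft_Inr:
  assumes u: "rooted_tree u" and T: "rooted_tree T" and v: "v \<in> verts u" and e: "e \<in> edges T"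
  shows "remaining_part (graft u v T) (Inr ` e) = graft u v (remaining_part T e)"
    "pruned_part (graft u v T) (Inr ` e) = relabel Inr (pruned_part T e)"
proof -
  obtain a where a: "joinable (remaining_part T e) a (pruned_part T e)"
    "T = join (remaining_part T e) a (pruned_part T e)" "e = {a, root (pruned_part T e)}"
    using cut_edge[OF T e] .
  let ?A = "remaining_part T e" and ?B = "pruned_part T e"
  note A = joinableD[OF a(1)]
  have eq: "graft u v (join A a B) = join (graft u v A) (Inr a) (relabel Inr B)" for A a B
    by (simp add: graft_eq_join relabel_join join_join_inner)
  have J: "joinable (graft u v ?A) (Inr a) (relabel Inr ?B)"
    unfolding joinable_def using A u v by (auto intro!: rooted_tree_graft rooted_tree_relabel)
  have g: "graft u v T = join (graft u v ?A) (Inr a) (relabel Inr ?B)" using eq a(2) by metis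
  have e': "Inr ` e = {Inr a, root (relabel Inr ?B)}" using arg_cong[OF a(3), of "(`) Inr"] by simp
  show "remaining_part (graft u v T) (Inr ` e) = graft u v ?A"
    unfolding g e' by (rule remaining_part_join[OF J])
  show "pruned_part (graft u v T) (Inr ` e) = relabel Inr ?B"
    unfolding g e' by (rule pruned_part_join[OF J])
qed

text \<open>Cutting an edge of the lower tree: the grafted copy stays on the side of the vertex \<open>v\<close> at which it is attached.\<close>

lemma cut_graft_Inl:
  assumes u: "rooted_tree u" and T: "rooted_tree T" and e: "e \<in> edges u"
  shows "v \<in> verts (remaining_part u e) \<Longrightarrow>
      remaining_part (graft u v T) (Inl ` e) = graft (remaining_part u e) v T \<and>
      pruned_part (graft u v T) (Inl ` e) = relabel Inl (pruned_part u e)"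
    "v \<in> verts (pruned_part u e) \<Longrightarrow>
      remaining_part (graft u v T) (Inl ` e) = relabel Inl (remaining_part u e) \<and>
      pruned_part (graft u v T) (Inl ` e) = graft (pruned_part u e) v T"
proof -
  obtain a where a: "joinable (remaining_part u e) a (pruned_part u e)"
    "u = join (remaining_part u e) a (pruned_part u e)" "e = {a, root (pruned_part u e)}"
    using cut_edge[OF u e] .
  let ?A = "remaining_part u e" and ?B = "pruned_part u e"
  note A = joinableD[OF a(1)]
  have e': "Inl ` e = {Inl a, root (relabel Inl ?B)}" 
    using arg_cong[OF a(3), of "(`) Inl"] by simp
  have e'': "Inl ` e = {Inl a, root (graft ?B v T)}"
    using e' by (simp add: graft_eq_join)
  {
    assume v: "v \<in> verts ?A"
    have eq: "graft (join A a B) v T = join (graft A v T) (Inl a) (relabel Inl B)" for A a B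
      by (simp add: graft_eq_join relabel_join join_join_swap)
    have J: "joinable (graft ?A v T) (Inl a) (relabel Inl ?B)"
      unfolding joinable_def using A T v by (auto intro!: rooted_tree_graft rooted_tree_relabel)
    have g: "graft u v T = join (graft ?A v T) (Inl a) (relabel Inl ?B)" using eq a(2) by metis
    show "remaining_part (graft u v T) (Inl ` e) = graft ?A v T \<and>
      pruned_part (graft u v T) (Inl ` e) = relabel Inl ?B"
      unfolding g e' using remaining_part_join[OF J] pruned_part_join[OF J] by blast
  next
    assume v: "v \<in> verts ?B"
    have eq: "graft (join A a B) v T = join (relabel Inl A) (Inl a) (graft B v T)" for A a B
      by (simp add: graft_eq_join relabel_join join_join_inner)
    have J: "joinable (relabel Inl ?A) (Inl a) (graft ?B v T)"
      unfolding joinable_def using A T v by (auto intro!: rooted_tree_graft rooted_tree_relabel)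
    have g: "graft u v T = join (relabel Inl ?A) (Inl a) (graft ?B v T)" using eq a(2) by metis
    show "remaining_part (graft u v T) (Inl ` e) = relabel Inl ?A \<and>
      pruned_part (graft u v T) (Inl ` e) = graft ?B v T"
      unfolding g e'' using remaining_part_join[OF J] pruned_part_join[OF J] by blast
  }
qed

lemma sum_edges_graft:
  assumes u: "rooted_tree u" and T: "rooted_tree T" and v: "v \<in> verts u"
  shows "(\<Sum>e\<in>edges (graft u v T). h e) = h {Inl v, Inr (root T)} +
     ((\<Sum>e\<in>edges u. h (Inl ` e)) + (\<Sum>e\<in>edges T. h (Inr ` e)))"
proof -
  have E: "edges (graft u v T) = insert {Inl v, Inr (root T)} ((`) Inl ` edges u \<union> (`) Inr ` edges T)"
    by (simp add: graft_def)
  have fin: "finite (edges u)" "finite (edges T)" using rooted_treeD(5) u T by auto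
  have ne: "{Inl v, Inr (root T)} \<notin> (`) Inl ` edges u \<union> (`) Inr ` edges T" by auto
  have dis: "((`) Inl ` edges u) \<inter> ((`) Inr ` edges T) = {}"
  proof -
    have "e \<noteq> {}" if "e \<in> edges u" for e using rooted_treeD(4)[OF u that] by auto
    then have "Inl ` e \<noteq> Inr ` e'" if "e \<in> edges u" for e and e' :: "'b set"
      using that by (metis Inl_Inr_False equals0I imageE imageI)
    then show ?thesis by blast
  qed
  have inj: "inj_on ((`) f) X" if "inj f" for f :: "'x \<Rightarrow> 'y" and X
    using inj_image_eq_iff[OF that] by (auto intro: inj_onI)
  show ?thesis
    unfolding E using fin ne dis
    by (simp add: sum.union_disjoint sum.reindex[OF inj])
qed

text \<open>After attaching \<open>t\<close>, the edge to be cut is either the new edge, which removes \<open>t\<close> again and is possible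
at each of the vertices of \<open>u\<close>; or an edge of \<open>t\<close>, where only a remaining part of \<open>t\<close> stays attached; or an edge of \<open>u\<close>
that keeps \<open>t\<close> connected to the root, where cutting commutes with attaching; or an edge of \<open>u\<close> that
separates \<open>t\<close> from the root, where the fallen part is a part of \<open>u\<close> with \<open>t\<close> attached to it.\<close>

lemma prune_attach:
  assumes u: "rooted_tree u"
  shows "attach t (\<lambda>w. prune s f (rep_rtree w)) u =
    kronecker s t * of_nat (card (verts u)) * f (tree_of u) +
    prune s (\<lambda>w. attach t f (rep_rtree w)) u +
    Sum_any (\<lambda>r. of_nat (tree_beta s t r) * prune r f u) +
    Sum_any (\<lambda>r. of_nat (tree_alpha s t r) * attach r f u)"
proof -
  let ?T = "rep_rtree t"
  let ?P = "pruned_part" and ?R = remaining_part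
  have T: "rooted_tree ?T" by (rule rooted_tree_rep)
  let ?h = "\<lambda>v e. kronecker s (tree_of (?P (graft u v ?T) e)) * f (tree_of (?R (graft u v ?T) e))"
  have "attach t (\<lambda>w. prune s f (rep_rtree w)) u = (\<Sum>v\<in>verts u. \<Sum>e\<in>edges (graft u v ?T). ?h v e)"
    unfolding attach_def
    by (intro sum.cong refl, subst prune_rep_tree_of) (auto simp: rooted_tree_graft u T prune_def simp del: graft_sel)
  also have "\<dots> = (\<Sum>v\<in>verts u. ?h v {Inl v, Inr (root ?T)} +
     ((\<Sum>e\<in>edges u. ?h v (Inl ` e)) + (\<Sum>e\<in>edges ?T. ?h v (Inr ` e))))"
    by (intro sum.cong refl sum_edges_graft u T)
  also have "\<dots> = (\<Sum>v\<in>verts u. ?h v {Inl v, Inr (root ?T)}) +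
     ((\<Sum>v\<in>verts u. \<Sum>e\<in>edges u. ?h v (Inl ` e)) + (\<Sum>v\<in>verts u. \<Sum>e\<in>edges ?T. ?h v (Inr ` e)))"
    by (simp only: sum.distrib)
  also have "(\<Sum>v\<in>verts u. ?h v {Inl v, Inr (root ?T)}) = (\<Sum>v\<in>verts u. kronecker s t * f (tree_of u))"
    by (intro sum.cong refl) (simp add: cut_graft_new_edge u T)
  also have "\<dots> = kronecker s t * of_nat (card (verts u)) * f (tree_of u)" by simp
  also have "(\<Sum>v\<in>verts u. \<Sum>e\<in>edges ?T. ?h v (Inr ` e)) =
     (\<Sum>e\<in>edges ?T. kronecker s (tree_of (?P ?T e)) * attach (tree_of (?R ?T e)) f u)"
    unfolding attach_def sum_distrib_left
    by (subst sum.swap, intro sum.cong refl) (simp add: cut_graft_Inr u T cut_tree)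
  also have "\<dots> = Sum_any (\<lambda>r. of_nat (tree_alpha s t r) * attach r f u)"
    by (subst sum_fibre[OF rooted_treeD(5)[OF T]]) (simp add: tree_alpha_eq prune_def)
  also have "(\<Sum>v\<in>verts u. \<Sum>e\<in>edges u. ?h v (Inl ` e)) =
     (\<Sum>e\<in>edges u. kronecker s (tree_of (?P u e)) * attach t f (?R u e) + attach t (kronecker s) (?P u e) * f (tree_of (?R u e)))"
  proof (subst sum.swap, intro sum.cong refl)
    fix e assume e: "e \<in> edges u"
    obtain a where a: "joinable (?R u e) a (?P u e)" "u = join (?R u e) a (?P u e)"
      using cut_edge[OF u e] .
    note A = joinableD[OF a(1)]
    have V: "verts u = verts (?R u e) \<union> verts (?P u e)" using a(2) join_sel(1) by metis
    have "(\<Sum>v\<in>verts u. ?h v (Inl ` e)) =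
      (\<Sum>v\<in>verts (?R u e). ?h v (Inl ` e)) + (\<Sum>v\<in>verts (?P u e). ?h v (Inl ` e))"
      unfolding V using A by (intro sum.union_disjoint) (auto simp: rooted_treeD(1))
    also have "(\<Sum>v\<in>verts (?R u e). ?h v (Inl ` e)) = kronecker s (tree_of (?P u e)) * attach t f (?R u e)"
      unfolding attach_def sum_distrib_left
      by (intro sum.cong refl) (simp add: cut_graft_Inl u T e A)
    also have "(\<Sum>v\<in>verts (?P u e). ?h v (Inl ` e)) = attach t (kronecker s) (?P u e) * f (tree_of (?R u e))"
      unfolding attach_def sum_distrib_right
      by (intro sum.cong refl) (simp add: cut_graft_Inl u T e A)
    finally show "(\<Sum>v\<in>verts u. ?h v (Inl ` e)) =
      kronecker s (tree_of (?P u e)) * attach t f (?R u e) + attach t (kronecker s) (?P u e) * f (tree_of (?R u e))" .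
  qed
  also have "\<dots> = (\<Sum>e\<in>edges u. kronecker s (tree_of (?P u e)) * attach t f (?R u e)) +
     (\<Sum>e\<in>edges u. attach t (kronecker s) (?P u e) * f (tree_of (?R u e)))" by (rule sum.distrib)
  also have "(\<Sum>e\<in>edges u. kronecker s (tree_of (?P u e)) * attach t f (?R u e)) =
      prune s (\<lambda>w. attach t f (rep_rtree w)) u"
    unfolding prune_def by (intro sum.cong refl) (simp add: cut_tree u)
  also have "(\<Sum>e\<in>edges u. attach t (kronecker s) (?P u e) * f (tree_of (?R u e))) =
      (\<Sum>e\<in>edges u. f (tree_of (?R u e)) * attach t (kronecker s) (rep_rtree (tree_of (?P u e))))"
    by (intro sum.cong refl) (simp add: cut_tree u)
  also have "\<dots> = Sum_any (\<lambda>r. of_nat (tree_beta s t r) * prune r f u)"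
    by (subst sum_fibre[OF rooted_treeD(5)[OF u], of _ "\<lambda>w. attach t (kronecker s) (rep_rtree w)"])
      (simp add: tree_beta_eq prune_def mult.commute)
  finally show ?thesis by simp
qed

text \<open>Cutting first at \<open>e\<close>, beyond \<open>e'\<close>, and then at \<open>e'\<close> has the same outcome as cutting at \<open>e'\<close> and then
dividing the fallen part at \<open>e\<close>.\<close>

lemma cut_cut_below:
  assumes u: "rooted_tree u" and e': "e' \<in> edges u" and e: "e \<in> edges (pruned_part u e')"
  shows "e \<in> edges u" "e' \<in> edges (remaining_part u e)" "e \<notin> edges (remaining_part u e')"
    "remaining_part (remaining_part u e) e' = remaining_part u e'"
    "pruned_part (remaining_part u e) e' = remaining_part (pruned_part u e') e"
    "pruned_part u e = pruned_part (pruned_part u e') e"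
proof -
  define A where "A = remaining_part u e'"
  define B where "B = pruned_part u e'"
  obtain a where a: "joinable A a B" "u = join A a B" "e' = {a, root B}"
    using cut_edge[OF u e'] unfolding A_def B_def .
  have eB: "e \<in> edges B" using e by (simp add: B_def)
  define C where "C = remaining_part B e"
  define K where "K = pruned_part B e"
  obtain b where b: "joinable C b K" "B = join C b K" "e = {b, root K}"
    using cut_edge[OF joinableD(2)[OF a(1)] eB] unfolding C_def K_def .
  note ad = joinableD[OF a(1)] and bd = joinableD[OF b(1)]
  have J: "joinable A a C" using ad bd b(2) by (auto simp: joinable_def)
  have J2: "joinable (join A a C) b K"
    using ad bd b(2) rooted_tree_join[OF J] by (auto simp: joinable_def)
  have u2: "u = join (join A a C) b K" by (simp add: a(2) b(2) join_join_inner)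
  have R: "remaining_part u e = join A a C" "pruned_part u e = K"
    unfolding u2 b(3) by (rule remaining_part_join[OF J2], rule pruned_part_join[OF J2])
  have e'2: "e' = {a, root C}" using a(3) b(2) by simp
  show "e \<in> edges u" by (simp add: u2 b(3))
  show "e' \<in> edges (remaining_part u e)" by (simp add: R e'2)
  show "e \<notin> edges (remaining_part u e')"
    using rooted_treeD(3)[OF ad(1)] bd ad(4) b(2,3) by (fastforce simp: A_def[symmetric])
  show "remaining_part (remaining_part u e) e' = remaining_part u e'"
    using remaining_part_join[OF J] by (simp only: R(1) A_def[symmetric] e'2[symmetric])
  show "pruned_part (remaining_part u e) e' = remaining_part (pruned_part u e') e"
    using pruned_part_join[OF J] by (simp only: R(1) B_def[symmetric] C_def[symmetric] e'2[symmetric])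
  show "pruned_part u e = pruned_part (pruned_part u e') e"
    unfolding R(2) by (simp add: K_def B_def)
qed

text \<open>Two edges, neither of which lies beyond the other, can be cut in either order.\<close>

lemma cut_cut_disjoint:
  assumes u: "rooted_tree u" and e': "e' \<in> edges u" and e: "e \<in> edges (remaining_part u e')"
    and side: "e' \<in> edges (remaining_part u e)"
  shows "e \<in> edges u"
    "pruned_part (remaining_part u e) e' = pruned_part u e'"
    "pruned_part u e = pruned_part (remaining_part u e') e"
    "remaining_part (remaining_part u e) e' = remaining_part (remaining_part u e') e"
proof -
  define A where "A = remaining_part u e'"
  define B where "B = pruned_part u e'"
  obtain a where a: "joinable A a B" "u = join A a B" "e' = {a, root B}"
    using cut_edge[OF u e'] unfolding A_def B_def .
  have eA: "e \<in> edges A" using e by (simp add: A_def)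
  then show eu: "e \<in> edges u" by (simp add: a(2))
  define C where "C = remaining_part A e"
  define K where "K = pruned_part A e"
  obtain b where b: "joinable C b K" "A = join C b K" "e = {b, root K}"
    using cut_edge[OF joinableD(1)[OF a(1)] eA] unfolding C_def K_def .
  note ad = joinableD[OF a(1)] and bd = joinableD[OF b(1)]
  have aC: "a \<in> verts C"
  proof (rule ccontr)
    assume "a \<notin> verts C"
    then have aK: "a \<in> verts K" using ad(3) b(2) by auto
    have JK: "joinable K a B" using ad bd b(2) aK by (auto simp: joinable_def)
    have J: "joinable C b (join K a B)"
      using ad bd b(2) rooted_tree_join[OF JK] by (auto simp: joinable_def)
    have u2: "u = join C b (join K a B)" using a(2) b(2) join_join_inner by metis
    have e2: "e = {b, root (join K a B)}" using b(3) by simp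
    have "remaining_part u e = C" unfolding u2 e2 by (rule remaining_part_join[OF J])
    then have "e' \<in> edges C" using side by simp
    then show False using rooted_treeD(3)[OF bd(1)] a(3) \<open>a \<notin> verts C\<close> by auto
  qed
  have J: "joinable C a B" using ad bd b(2) aC by (auto simp: joinable_def)
  have J2: "joinable (join C a B) b K"
    using ad bd b(2) rooted_tree_join[OF J] by (auto simp: joinable_def)
  have u2: "u = join (join C a B) b K" using a(2) b(2) join_join_swap by metis
  have R: "remaining_part u e = join C a B" "pruned_part u e = K"
    unfolding u2 b(3) by (rule remaining_part_join[OF J2], rule pruned_part_join[OF J2])
  show "pruned_part (remaining_part u e) e' = pruned_part u e'"
    using pruned_part_join[OF J] by (simp only: R(1) B_def[symmetric] a(3)[symmetric])
  show "pruned_part u e = pruned_part (remaining_part u e') e"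
    unfolding R(2) by (simp add: K_def A_def)
  show "remaining_part (remaining_part u e) e' = remaining_part (remaining_part u e') e"
    using remaining_part_join[OF J] by (simp only: R(1) A_def[symmetric] C_def[symmetric] a(3)[symmetric])
qed

lemma cut_cut_cases:
  assumes u: "rooted_tree u" and e: "e \<in> edges u" and e': "e' \<in> edges (remaining_part u e)"
  shows "e' \<in> edges u" "e \<in> edges (remaining_part u e') \<or> e \<in> edges (pruned_part u e')"
proof -
  obtain a where a: "joinable (remaining_part u e) a (pruned_part u e)"
    "u = join (remaining_part u e) a (pruned_part u e)" "e = {a, root (pruned_part u e)}"
    using cut_edge[OF u e] .
  note ad = joinableD[OF a(1)]
  have "edges u = insert e (edges (remaining_part u e) \<union> edges (pruned_part u e))"
    using a(2,3) join_sel(2) by metis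
  then show e'u: "e' \<in> edges u" using e' by simp
  have "e \<noteq> e'"
    using rooted_treeD(3)[OF ad(1) e'] rooted_treeD(2)[OF ad(2)] ad(4) a(3) by blast
  obtain b where "u = join (remaining_part u e') b (pruned_part u e')" "e' = {b, root (pruned_part u e')}"
    using cut_edge[OF u e'u] .
  then have "edges u = insert e' (edges (remaining_part u e') \<union> edges (pruned_part u e'))"
    using join_sel(2) by metis
  then show "e \<in> edges (remaining_part u e') \<or> e \<in> edges (pruned_part u e')"
    using e \<open>e \<noteq> e'\<close> by auto
qed

text \<open>Consecutive cuts are either independent, or the second one is nearer to the root than the first. The former
pairs of edges form the explicit sum, which is symmetric in \<open>s\<close> and \<open>t\<close>; the latter are counted by
splitting the part that falls off at the second edge.\<close>

lemma prune_prune: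
  assumes u: "rooted_tree u"
  shows "prune t (\<lambda>w. prune s f (rep_rtree w)) u =
    (\<Sum>(e, e') | e \<in> edges (remaining_part u e') \<and> e' \<in> edges (remaining_part u e) \<and> e \<in> edges u \<and> e' \<in> edges u.
      kronecker t (tree_of (pruned_part u e)) * kronecker s (tree_of (pruned_part u e')) *
      f (tree_of (remaining_part (remaining_part u e) e'))) +
    Sum_any (\<lambda>r. of_nat (tree_alpha t r s) * prune r f u)"
proof -
  let ?P = "pruned_part" and ?R = remaining_part
  let ?h = "\<lambda>(e, e'). kronecker t (tree_of (?P u e)) * kronecker s (tree_of (?P (?R u e) e')) * f (tree_of (?R (?R u e) e'))"
  let ?S1 = "{(e, e'). e \<in> edges (?R u e') \<and> e' \<in> edges (?R u e) \<and> e \<in> edges u \<and> e' \<in> edges u}"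
  let ?S2 = "(\<lambda>(e', e). (e, e')) ` Sigma (edges u) (\<lambda>e'. edges (?P u e'))"
  have fin: "finite (edges u)" by (rule rooted_treeD(5)[OF u])
  have finR: "finite (edges (?R u e))" "finite (edges (?P u e))" if "e \<in> edges u" for e
    using rooted_treeD(5) cut_tree[OF u that] by blast+
  have "prune t (\<lambda>w. prune s f (rep_rtree w)) u =
     (\<Sum>e\<in>edges u. \<Sum>e'\<in>edges (?R u e). ?h (e, e'))"
    unfolding prune_def[of t]
    by (intro sum.cong refl) (simp add: cut_tree u, simp add: prune_def sum_distrib_left mult.assoc)
  also have "\<dots> = (\<Sum>p\<in>Sigma (edges u) (\<lambda>e. edges (?R u e)). ?h p)"
    using fin finR by (subst sum.Sigma) (auto simp: case_prod_beta)
  also have "Sigma (edges u) (\<lambda>e. edges (?R u e)) = ?S1 \<union> ?S2"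
  proof (intro set_eqI)
    fix p :: "'a set \<times> 'a set"
    obtain e e' where p: "p = (e, e')" by (cases p)
    have "p \<in> ?S2 \<longleftrightarrow> e' \<in> edges u \<and> e \<in> edges (?P u e')" unfolding p by (force simp: image_iff)
    then show "p \<in> Sigma (edges u) (\<lambda>e. edges (?R u e)) \<longleftrightarrow> p \<in> ?S1 \<union> ?S2"
      using cut_cut_cases[OF u] cut_cut_below(1,2)[OF u] unfolding p by blast
  qed
  also have "(\<Sum>p\<in>?S1 \<union> ?S2. ?h p) = (\<Sum>p\<in>?S1. ?h p) + (\<Sum>p\<in>?S2. ?h p)"
  proof (rule sum.union_disjoint)
    show "finite ?S1" by (rule finite_subset[of _ "edges u \<times> edges u"]) (use fin in auto)
    show "finite ?S2" using fin finR by auto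
    show "?S1 \<inter> ?S2 = {}" using cut_cut_below(3)[OF u] by auto
  qed
  also have "(\<Sum>p\<in>?S1. ?h p) = (\<Sum>(e, e')\<in>?S1. kronecker t (tree_of (?P u e)) * kronecker s (tree_of (?P u e')) *
      f (tree_of (?R (?R u e) e')))"
    by (intro sum.cong refl) (auto simp: cut_cut_disjoint(2)[OF u])
  also have "(\<Sum>p\<in>?S2. ?h p) = (\<Sum>(e', e)\<in>Sigma (edges u) (\<lambda>e'. edges (?P u e')). ?h (e, e'))"
    by (subst sum.reindex) (auto simp: inj_on_def case_prod_beta)
  also have "\<dots> = (\<Sum>e'\<in>edges u. \<Sum>e\<in>edges (?P u e'). ?h (e, e'))"
    using fin finR by (subst sum.Sigma) auto
  also have "\<dots> = (\<Sum>e'\<in>edges u. f (tree_of (?R u e')) * prune t (kronecker s) (rep_rtree (tree_of (?P u e'))))"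
  proof (intro sum.cong refl)
    fix e' assume e': "e' \<in> edges u"
    have "(\<Sum>e\<in>edges (?P u e'). ?h (e, e')) = f (tree_of (?R u e')) * prune t (kronecker s) (?P u e')"
      unfolding prune_def sum_distrib_left
    proof (intro sum.cong refl)
      fix e assume e: "e \<in> edges (?P u e')"
      show "?h (e, e') = f (tree_of (?R u e')) *
        (kronecker t (tree_of (?P (?P u e') e)) * kronecker s (tree_of (?R (?P u e') e)))"
        by (simp add: cut_cut_below[OF u e' e])
    qed
    then show "(\<Sum>e\<in>edges (?P u e'). ?h (e, e')) =
        f (tree_of (?R u e')) * prune t (kronecker s) (rep_rtree (tree_of (?P u e')))"
      using cut_tree[OF u e'] by simp
  qed
  also have "\<dots> = Sum_any (\<lambda>r. of_nat (tree_alpha t r s) * prune r f u)"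
    by (subst sum_fibre[OF fin, of _ "\<lambda>w. prune t (kronecker s) (rep_rtree w)"])
      (simp add: tree_alpha_eq prune_def mult.commute)
  finally show ?thesis by simp
qed

lemma prune_commutator:
  assumes u: "rooted_tree u"
  shows "prune t (\<lambda>w. prune s f (rep_rtree w)) u - prune s (\<lambda>w. prune t f (rep_rtree w)) u =
    Sum_any (\<lambda>r. of_nat (tree_alpha t r s) * prune r f u) -
    Sum_any (\<lambda>r. of_nat (tree_alpha s r t) * prune r f u)"
proof -
  let ?P = "pruned_part" and ?R = remaining_part
  let ?S1 = "{(e, e'). e \<in> edges (?R u e') \<and> e' \<in> edges (?R u e) \<and> e \<in> edges u \<and> e' \<in> edges u}"
  let ?h = "\<lambda>s t (e, e'). kronecker t (tree_of (?P u e)) * kronecker s (tree_of (?P u e')) *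
      f (tree_of (?R (?R u e) e'))"
  have "sum (?h s t) ?S1 = sum (?h t s) ?S1"
    by (rule sum.reindex_bij_witness[of _ prod.swap prod.swap])
      (auto simp: mult_ac cut_cut_disjoint(4)[OF u])
  then show ?thesis unfolding prune_prune[OF u] by simp
qed

section \<open>Sizes, root degrees and the separation of trees by their cuts\<close>

lemma tree_size_tree_of [simp]:
  assumes "rooted_tree G"
  shows "tree_size (tree_of G) = card (verts G)"
proof -
  obtain h where "inj_on h (verts G)" "rep_rtree (tree_of G) = relabel h G" using rep_tree_of_E[OF assms] .
  then show ?thesis by (simp add: tree_size_def card_image)
qed

lemma tree_size_graft:
  assumes "rooted_tree G" "rooted_tree T" "v \<in> verts G"
  shows "tree_size (tree_of (graft G v T)) = tree_size (tree_of G) + tree_size (tree_of T)"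
proof -
  have "card (Inl ` verts G \<union> Inr ` verts T) = card (verts G) + card (verts T)"
    using rooted_treeD(1)[OF assms(1)] rooted_treeD(1)[OF assms(2)]
    by (subst card_Un_disjoint) (auto simp: card_image)
  then show ?thesis using assms rooted_tree_graft[OF assms] by simp
qed

lemma tree_size_pos: "tree_size t \<ge> 1"
  using rooted_treeD(1,2)[OF rooted_tree_rep, of t] unfolding tree_size_def
  by (metis One_nat_def Suc_leI card_gt_0_iff empty_iff)

definition bullet_graph :: "nat rgraph" where
  "bullet_graph = RGraph {0} {} 0"

definition bullet :: rtree where
  "bullet = tree_of bullet_graph"

lemma bullet_graph_sel [simp]:
  "verts bullet_graph = {0}" "edges bullet_graph = {}" "root bullet_graph = 0"
  by (simp_all add: bullet_graph_def)

lemma rooted_tree_bullet [simp]: "rooted_tree bullet_graph"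
  by (simp add: rooted_tree_iff_bridges)

lemma tree_size_bullet [simp]: "tree_size bullet = 1"
  by (simp add: bullet_def)

lemma tree_size_eq_1_iff: "tree_size t = 1 \<longleftrightarrow> t = bullet"
proof
  assume "tree_size t = 1"
  then obtain x where x: "verts (rep_rtree t) = {x}" by (auto simp: tree_size_def card_1_singleton_iff)
  note t = rooted_treeD[OF rooted_tree_rep[of t]]
  have "edges (rep_rtree t) = {}"
  proof (rule ccontr)
    assume "edges (rep_rtree t) \<noteq> {}"
    then obtain e where e: "e \<in> edges (rep_rtree t)" by auto
    then show False using t(3,4)[OF e] x by (auto simp: subset_singleton_iff)
  qed
  then have "rep_rtree t = relabel (\<lambda>_. x) bullet_graph"
    using x t(2) by (cases "rep_rtree t") (auto simp: relabel_def)
  then have "tree_of (rep_rtree t) = tree_of bullet_graph" by simp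
  then show "t = bullet" by (simp add: bullet_def)
qed simp

text \<open>The structure constants may be computed on any representing graph.\<close>

lemma tree_beta_tree_of:
  assumes "rooted_tree G"
  shows "tree_beta r s (tree_of G) = card {v \<in> verts G. r = tree_of (graft G v (rep_rtree s))}"
proof -
  have "(of_nat (tree_beta r s (tree_of G)) :: complex) = attach s (kronecker r) G"
    using assms by (simp add: tree_beta_eq)
  also have "\<dots> = of_nat (card {v \<in> verts G. r = tree_of (graft G v (rep_rtree s))})"
    unfolding attach_def kronecker_def of_nat_card_kronecker[OF rooted_treeD(1)[OF assms]] ..
  finally show ?thesis by (simp only: of_nat_eq_iff)
qed

lemma tree_alpha_tree_of:
  assumes "rooted_tree G"
  shows "tree_alpha s (tree_of G) r =
    card {e \<in> edges G. s = tree_of (pruned_part G e) \<and> r = tree_of (remaining_part G e)}"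
proof -
  have "(of_nat (tree_alpha s (tree_of G) r) :: complex) = prune s (kronecker r) G"
    using assms by (simp add: tree_alpha_eq)
  also have "\<dots> = of_nat (card {e \<in> edges G. s = tree_of (pruned_part G e) \<and> r = tree_of (remaining_part G e)})"
    unfolding prune_def kronecker_def of_nat_card_kronecker[OF rooted_treeD(5)[OF assms]]
    by (intro sum.cong refl) auto
  finally show ?thesis by (simp only: of_nat_eq_iff)
qed

text \<open>\<open>t\<close> decomposes as $r \cup_v s$ for some vertex \<open>v\<close>. This is the common support of the structure
constants \<open>\<alpha>(s,t,r)\<close> and \<open>\<beta>(t,s,r)\<close>, although these numbers differ in general.\<close>

definition grafted :: "rtree \<Rightarrow> rtree \<Rightarrow> rtree \<Rightarrow> bool" where
  "grafted t s r \<longleftrightarrow> (\<exists>v\<in>verts (rep_rtree r). t = tree_of (graft (rep_rtree r) v (rep_rtree s)))"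

lemma tree_beta_nonzero_iff: "tree_beta t s r \<noteq> 0 \<longleftrightarrow> grafted t s r"
  using tree_beta_tree_of[OF rooted_tree_rep, of t s r] rooted_treeD(1)[OF rooted_tree_rep, of r]
  by (auto simp: grafted_def)

lemma tree_of_join_graft_rep:
  assumes J: "joinable A a B"
  obtains v where "v \<in> verts (rep_rtree (tree_of A))"
    "tree_of (join A a B) = tree_of (graft (rep_rtree (tree_of A)) v (rep_rtree (tree_of B)))"
    "a = root A \<Longrightarrow> v = root (rep_rtree (tree_of A))"
proof -
  note A = joinableD[OF J]
  obtain h where h: "inj_on h (verts A)" "rep_rtree (tree_of A) = relabel h A" using rep_tree_of_E[OF A(1)] .
  have "tree_of (join A a B) = tree_of (graft A a (rep_rtree (tree_of B)))"
    using A by (simp add: tree_of_join_eq_graft J)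
  also have "\<dots> = tree_of (graft (relabel h A) (h a) (rep_rtree (tree_of B)))"
    by (rule tree_of_graft_relabel[symmetric]) (use A rooted_tree_rep h in auto)
  finally show thesis using that[of "h a"] A(3) h by simp
qed

lemma tree_alpha_nonzero_iff: "tree_alpha s t r \<noteq> 0 \<longleftrightarrow> grafted t s r"
proof
  assume "tree_alpha s t r \<noteq> 0"
  then obtain e where e: "e \<in> edges (rep_rtree t)" "s = tree_of (pruned_part (rep_rtree t) e)"
    "r = tree_of (remaining_part (rep_rtree t) e)"
    using tree_alpha_tree_of[OF rooted_tree_rep, of s t r] by (metis (mono_tags, lifting) Collect_empty_eq card.empty tree_of_rep)
  obtain a where a: "joinable (remaining_part (rep_rtree t) e) a (pruned_part (rep_rtree t) e)"
      "rep_rtree t = join (remaining_part (rep_rtree t) e) a (pruned_part (rep_rtree t) e)"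
    using cut_edge[OF rooted_tree_rep e(1)] .
  obtain v where "v \<in> verts (rep_rtree r)"
    "tree_of (join (remaining_part (rep_rtree t) e) a (pruned_part (rep_rtree t) e)) =
     tree_of (graft (rep_rtree r) v (rep_rtree s))"
    using tree_of_join_graft_rep[OF a(1)] e by metis
  then show "grafted t s r" unfolding grafted_def a(2)[symmetric] by auto
next
  assume "grafted t s r"
  then obtain v where v: "v \<in> verts (rep_rtree r)" "t = tree_of (graft (rep_rtree r) v (rep_rtree s))"
    by (auto simp: grafted_def)
  let ?G = "graft (rep_rtree r) v (rep_rtree s)"
  have G: "rooted_tree ?G" by (rule rooted_tree_graft[OF rooted_tree_rep rooted_tree_rep v(1)])
  have "{Inl v, Inr (root (rep_rtree s))} \<in>
    {e \<in> edges ?G. s = tree_of (pruned_part ?G e) \<and> r = tree_of (remaining_part ?G e)}"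
    using cut_graft_new_edge[OF rooted_tree_rep rooted_tree_rep v(1)]
    by (simp add: rooted_tree_rep) (simp add: graft_def)
  moreover have "finite {e \<in> edges ?G. s = tree_of (pruned_part ?G e) \<and> r = tree_of (remaining_part ?G e)}"
    using rooted_treeD(5)[OF G] by simp
  ultimately show "tree_alpha s t r \<noteq> 0"
    unfolding v(2) tree_alpha_tree_of[OF G] by auto
qed

lemma grafted_size: "grafted t s r \<Longrightarrow> tree_size t = tree_size r + tree_size s"
  by (auto simp: grafted_def tree_size_graft rooted_tree_rep)

text \<open>A tree is recovered from \<open>r\<close> and \<open>s\<close> by a vertex of \<open>r\<close>; the parts of a cut of \<open>t\<close> are recovered from an edge of \<open>t\<close>.\<close>

lemma finite_grafted: 
  "finite {t. grafted t s r}" "finite {r. grafted t s r}"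
proof -
  let ?G = "rep_rtree t"
  have "{t. grafted t s r} \<subseteq> (\<lambda>v. tree_of (graft (rep_rtree r) v (rep_rtree s))) ` verts (rep_rtree r)"
    by (auto simp: grafted_def)
  then show "finite {t. grafted t s r}"
    using finite_subset rooted_treeD(1)[OF rooted_tree_rep] by blast
  have cut: "\<exists>e\<in>edges ?G. s = tree_of (pruned_part ?G e) \<and> r = tree_of (remaining_part ?G e)"
    if "grafted t s r" for s r
    using that tree_alpha_nonzero_iff[of s t r] tree_alpha_tree_of[OF rooted_tree_rep, of s t r]
    by (metis (mono_tags, lifting) Collect_empty_eq card.empty tree_of_rep)
  have E: "finite (edges ?G)" by (rule rooted_treeD(5)[OF rooted_tree_rep])
  have "{r. grafted t s r} \<subseteq> (\<lambda>e. tree_of (remaining_part ?G e)) ` edges ?G"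
    using cut by blast
  then show "finite {r. grafted t s r}" using E finite_subset by blast
qed

definition root_degree :: "rtree \<Rightarrow> nat" where
  "root_degree t = card {e \<in> edges (rep_rtree t). root (rep_rtree t) \<in> e}"

lemma root_degree_tree_of:
  assumes G: "rooted_tree G"
  shows "root_degree (tree_of G) = card {e \<in> edges G. root G \<in> e}"
proof -
  obtain h where h: "inj_on h (verts G)" "rep_rtree (tree_of G) = relabel h G" using rep_tree_of_E[OF G] .
  have inj: "inj_on ((`) h) (edges G)"
    using inj_on_image_eq_iff[OF h(1)] rooted_treeD(3)[OF G] by (auto intro!: inj_onI)
  have "h (root G) \<in> h ` e \<longleftrightarrow> root G \<in> e" if "e \<in> edges G" for e
    using inj_on_image_mem_iff[OF h(1) rooted_treeD(2)[OF G] rooted_treeD(3)[OF G that]] .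
  then have "{e \<in> (`) h ` edges G. h (root G) \<in> e} = (`) h ` {e \<in> edges G. root G \<in> e}" by auto
  then show ?thesis
    unfolding root_degree_def h(2) relabel_sel
    by (metis (mono_tags, lifting) card_image inj inj_on_subset mem_Collect_eq subsetI)
qed

lemma root_degree_graft:
  fixes G :: "'a rgraph" and T :: "'b rgraph"
  assumes G: "rooted_tree G" and T: "rooted_tree T" and v: "v \<in> verts G"
  shows "root_degree (tree_of (graft G v T)) = root_degree (tree_of G) + (if v = root G then 1 else 0)"
proof -
  let ?E = "{e \<in> edges G. root G \<in> e}"
  let ?i = "(`) (Inl :: 'a \<Rightarrow> 'a + 'b)"
  have fin: "finite (?i ` ?E)" using rooted_treeD(5)[OF G] by simp
  have ne: "{Inl v, Inr (root T)} \<notin> ?i ` ?E" by auto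
  have "inj ?i" using inj_image_eq_iff[OF inj_Inl] by (auto intro: injI)
  then have card: "card (?i ` ?E) = card ?E" by (meson card_image inj_on_subset subset_UNIV)
  have "{e \<in> edges (graft G v T). root (graft G v T) \<in> e} =
    (if v = root G then insert {Inl v, Inr (root T)} (?i ` ?E) else ?i ` ?E)"
    by (auto simp: graft_def)
  then show ?thesis
    using card_insert_disjoint[OF fin ne] card root_degree_tree_of[OF rooted_tree_graft[OF G T v]]
      root_degree_tree_of[OF G] by (cases "v = root G") simp_all
qed

text \<open>Cutting any edge at the root splits off a branch of the root.\<close>

lemma root_graft_decomposition:
  assumes "tree_size t \<ge> 2"
  obtains r s where "t = tree_of (graft (rep_rtree r) (root (rep_rtree r)) (rep_rtree s))"
proof -
  let ?G = "rep_rtree t"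
  have G: "rooted_tree ?G" by (rule rooted_tree_rep)
  note tG = rooted_treeD[OF G]
  have "verts ?G \<noteq> {root ?G}" using assms by (auto simp: tree_size_def)
  then obtain w where w: "w \<in> verts ?G" "w \<noteq> root ?G" using tG(2) by auto
  obtain x where x: "{root ?G, x} \<in> edges ?G"
    using tG(6)[OF w(1)] w(2) by (metis adj_iff converse_rtranclE)
  let ?e = "{root ?G, x}"
  obtain a where a: "joinable (remaining_part ?G ?e) a (pruned_part ?G ?e)"
    "?G = join (remaining_part ?G ?e) a (pruned_part ?G ?e)" "?e = {a, root (pruned_part ?G ?e)}"
    using cut_edge[OF G x] .
  define A where "A = remaining_part ?G ?e"
  define B where "B = pruned_part ?G ?e"
  have J: "joinable A a B" and GJ: "?G = join A a B" and e: "?e = {a, root B}"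
    using a unfolding A_def B_def by auto
  have rA: "root ?G = root A" by (subst GJ) simp
  have "root A \<noteq> root B" using joinableD[OF J] rooted_treeD(2) by (metis disjoint_iff)
  then have "a = root A" using e rA by (metis doubleton_eq_iff)
  then obtain v where "v = root (rep_rtree (tree_of A))"
    "tree_of (join A a B) = tree_of (graft (rep_rtree (tree_of A)) v (rep_rtree (tree_of B)))"
    using tree_of_join_graft_rep[OF J] by metis
  then show thesis using that[of "tree_of A" "tree_of B"] GJ by (metis tree_of_rep)
qed

text \<open>Think of \<open>\<kappa>\<close> as either of the families of structure constants. Choose a tree of minimal root degree with nonzero
coefficient and split it into a root branch \<open>s\<close> and the rest \<open>r\<close>. All other ways of composing \<open>s\<close> and \<open>r\<close>
leave the root degree of \<open>r\<close> unchanged, which is smaller by one, so by minimality they carry no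
coefficient, and the equation for \<open>(s, r)\<close> has a single nonzero term.\<close>

lemma grafting_separates_trees:
  fixes a :: "rtree \<Rightarrow> complex"
  assumes fin: "finite A" and size: "\<And>t. t \<in> A \<Longrightarrow> tree_size t = n" and n: "n \<ge> 2"
    and \<kappa>: "\<And>s t r. \<kappa> s t r \<noteq> 0 \<longleftrightarrow> grafted t s r"
    and zero: "\<And>s r. tree_size s + tree_size r = n \<Longrightarrow> (\<Sum>t\<in>A. a t * \<kappa> s t r) = 0"
    and t: "t \<in> A"
  shows "a t = 0"
proof (rule ccontr)
  assume "a t \<noteq> 0"
  then have "\<exists>t. t \<in> A \<and> a t \<noteq> 0" using t by blast
  then obtain t where t: "t \<in> A" "a t \<noteq> 0"
    and least: "\<And>t'. t' \<in> A \<Longrightarrow> a t' \<noteq> 0 \<Longrightarrow> root_degree t \<le> root_degree t'"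
    using ex_has_least_nat[of "\<lambda>t. t \<in> A \<and> a t \<noteq> 0" _ root_degree] by blast
  have "tree_size t \<ge> 2" using size[OF t(1)] n by simp
  then obtain r s where rs: "t = tree_of (graft (rep_rtree r) (root (rep_rtree r)) (rep_rtree s))"
    using root_graft_decomposition by blast
  note R = rooted_tree_rep[of r] and S = rooted_tree_rep[of s]
  have root: "root (rep_rtree r) \<in> verts (rep_rtree r)" by (rule rooted_treeD(2)[OF R])
  have g: "grafted t s r" using rs root by (auto simp: grafted_def)
  have "tree_size s + tree_size r = n" using grafted_size[OF g] size[OF t(1)] by simp
  then have "(\<Sum>t'\<in>A. a t' * \<kappa> s t' r) = 0" by (rule zero)
  moreover have "(\<Sum>t'\<in>A - {t}. a t' * \<kappa> s t' r) = 0"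
  proof (rule sum.neutral, rule ballI)
    fix t' assume t': "t' \<in> A - {t}"
    show "a t' * \<kappa> s t' r = 0"
    proof (rule ccontr)
      assume "\<not> ?thesis"
      then have "a t' \<noteq> 0" "grafted t' s r" using \<kappa> by auto
      then obtain v where v: "v \<in> verts (rep_rtree r)" "t' = tree_of (graft (rep_rtree r) v (rep_rtree s))"
        by (auto simp: grafted_def)
      then have "v \<noteq> root (rep_rtree r)" using rs t' by auto
      then have "root_degree t' < root_degree t"
        using v rs by (simp add: root_degree_graft R S root)
      then show False using least[of t'] t' \<open>a t' \<noteq> 0\<close> by simp
    qed
  qed
  ultimately have "a t * \<kappa> s t r = 0" using t(1) fin by (simp add: sum.remove)
  then show False using t(2) \<kappa>[of s t r] g by simp
qed

text \<open>The trees with exactly one root branch; on them \<^const>\<open>prune\<close> isolates a single coefficient.\<close>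

definition root_up :: "rtree \<Rightarrow> rtree" where
  "root_up t = tree_of (graft bullet_graph 0 (rep_rtree t))"

lemma rooted_tree_root_up: "rooted_tree (graft bullet_graph 0 (rep_rtree t))"
  by (intro rooted_tree_graft rooted_tree_rep) auto

lemma tree_size_root_up: "tree_size (root_up t) = Suc (tree_size t)"
  by (simp add: root_up_def tree_size_graft rooted_tree_rep)

text \<open>Only the cut at the root edge leaves a single vertex.\<close>

lemma prune_root_up: "prune s (kronecker bullet) (rep_rtree (root_up t)) = kronecker s t"
proof -
  let ?G = "graft bullet_graph 0 (rep_rtree t)"
  have "prune s (kronecker bullet) (rep_rtree (root_up t)) = prune s (kronecker bullet) ?G"
    unfolding root_up_def using rooted_tree_root_up by simp
  also have "\<dots> = kronecker s t +
      (\<Sum>e\<in>edges (rep_rtree t). kronecker s (tree_of (pruned_part ?G (Inr ` e))) * kronecker bullet (tree_of (remaining_part ?G (Inr ` e))))"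
    unfolding prune_def
    by (subst sum_edges_graft)
      (auto simp: rooted_tree_rep cut_graft_new_edge, simp add: kronecker_def bullet_def)
  also have "(\<Sum>e\<in>edges (rep_rtree t). kronecker s (tree_of (pruned_part ?G (Inr ` e))) * kronecker bullet (tree_of (remaining_part ?G (Inr ` e)))) = 0"
  proof (intro sum.neutral ballI)
    fix e assume e: "e \<in> edges (rep_rtree t)"
    let ?A = "remaining_part (rep_rtree t) e"
    have A: "rooted_tree ?A" by (rule cut_tree[OF rooted_tree_rep e])
    have "tree_size (tree_of (graft bullet_graph 0 ?A)) = 1 + tree_size (tree_of ?A)"
      using A by (subst tree_size_graft) auto
    then have "tree_size (tree_of (graft bullet_graph 0 ?A)) \<noteq> tree_size bullet"
      using tree_size_pos[of "tree_of ?A"] tree_size_bullet by linarith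
    then have "bullet \<noteq> tree_of (remaining_part ?G (Inr ` e))"
      using cut_graft_Inr(1)[OF rooted_tree_bullet rooted_tree_rep _ e, of 0] by auto
    then show "kronecker s (tree_of (pruned_part ?G (Inr ` e))) * kronecker bullet (tree_of (remaining_part ?G (Inr ` e))) = 0"
      by (simp add: kronecker_def)
  qed
  finally show ?thesis by simp
qed

lemma root_up_eq_iff: "root_up s = root_up t \<longleftrightarrow> s = t"
  using prune_root_up[of s s] prune_root_up[of s t] by (auto simp: kronecker_def split: if_splits)

section \<open>A faithful action of the algebra\<close>

lemma lookup_ie_scale [simp]: "Poly_Mapping.lookup (ie_scale c x) b = c * Poly_Mapping.lookup x b"
  unfolding ie_scale_def by transfer (simp add: when_def)

lemma lookup_Sum_any_single:
  assumes "finite {r. c r \<noteq> 0}" "inj B"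
  shows "Poly_Mapping.lookup (Sum_any (\<lambda>r. Poly_Mapping.single (B r) (c r))) (B r) = c r"
    "b \<notin> range B \<Longrightarrow> Poly_Mapping.lookup (Sum_any (\<lambda>r. Poly_Mapping.single (B r) (c r))) b = 0"
proof -
  have e: "Sum_any (\<lambda>r. Poly_Mapping.single (B r) (c r)) = (\<Sum>r | c r \<noteq> 0. Poly_Mapping.single (B r) (c r))"
    using assms(1) by (intro Sum_any.expand_superset) auto
  have "Poly_Mapping.lookup (Sum_any (\<lambda>r. Poly_Mapping.single (B r) (c r))) (B r) =
      (\<Sum>r' | c r' \<noteq> 0. if r' = r then c r else 0)"
    unfolding e lookup_sum
    by (intro sum.cong refl) (auto simp: lookup_single when_def inj_eq[OF assms(2)])
  then show "Poly_Mapping.lookup (Sum_any (\<lambda>r. Poly_Mapping.single (B r) (c r))) (B r) = c r"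
    using assms(1) by (simp add: sum.delta)
  show "Poly_Mapping.lookup (Sum_any (\<lambda>r. Poly_Mapping.single (B r) (c r))) b = 0" if "b \<notin> range B"
    unfolding e lookup_sum using that by (intro sum.neutral) (auto simp: lookup_single when_def)
qed

fun act :: "ie_basis \<Rightarrow> (rtree \<Rightarrow> complex) \<Rightarrow> rtree \<Rightarrow> complex" where
  "act D f u = of_nat (tree_size u) * f u"
| "act (DPlus t) f u = attach t f (rep_rtree u)"
| "act (DMinus t) f u = prune t f (rep_rtree u)"

text \<open>The bracket of the algebra corresponds to the commutator taken in the opposite order, since
functions of trees are dual to formal sums of trees.\<close>

definition rho :: "ie_algebra \<Rightarrow> (rtree \<Rightarrow> complex) \<Rightarrow> rtree \<Rightarrow> complex" where
  "rho x f u = (\<Sum>b\<in>Poly_Mapping.keys x. Poly_Mapping.lookup x b * act b f u)"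

lemma act_sum: "act b (\<lambda>w. \<Sum>i\<in>I. c i * f i w) u = (\<Sum>i\<in>I. c i * act b (f i) u)"
proof (cases b)
  case (DPlus t)
  then show ?thesis by (simp add: attach_def sum_distrib_left) (rule sum.swap)
next
  case (DMinus t)
  then show ?thesis
    by (simp add: prune_def sum_distrib_left mult.left_commute) (rule sum.swap)
qed (simp add: sum_distrib_left mult.left_commute)

lemma rho_superset:
  assumes "finite A" "Poly_Mapping.keys x \<subseteq> A"
  shows "rho x f u = (\<Sum>b\<in>A. Poly_Mapping.lookup x b * act b f u)"
  unfolding rho_def using assms by (intro sum.mono_neutral_left) (auto simp: in_keys_iff)

lemma rho_add: "rho (x + y) f u = rho x f u + rho y f u"
proof -
  let ?A = "Poly_Mapping.keys x \<union> Poly_Mapping.keys y"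
  have "rho z f u = (\<Sum>b\<in>?A. Poly_Mapping.lookup z b * act b f u)" if "z \<in> {x, y, x + y}" for z
    using that keys_add[of x y] by (intro rho_superset) auto
  then show ?thesis by (simp add: lookup_add ring_distribs sum.distrib)
qed

lemma rho_scale: "rho (ie_scale c x) f u = c * rho x f u"
proof -
  have "rho (ie_scale c x) f u = (\<Sum>b\<in>Poly_Mapping.keys x. Poly_Mapping.lookup (ie_scale c x) b * act b f u)"
    by (intro rho_superset) (auto simp: in_keys_iff)
  then show ?thesis by (simp add: rho_def sum_distrib_left mult.assoc)
qed

lemma rho_zero [simp]: "rho 0 f u = 0"
  by (simp add: rho_def)

lemma rho_uminus: "rho (- x) f u = - rho x f u"
  using rho_add[of x "- x" f u] by (simp add: eq_neg_iff_add_eq_0 add.commute)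

lemma rho_diff: "rho (x - y) f u = rho x f u - rho y f u"
  using rho_add[of x "- y" f u] by (simp add: rho_uminus)

lemma rho_sum: "rho (\<Sum>i\<in>I. x i) f u = (\<Sum>i\<in>I. rho (x i) f u)"
  by (induction I rule: infinite_finite_induct) (auto simp: rho_add)

lemma rho_single [simp]: "rho (Poly_Mapping.single b c) f u = c * act b f u"
  by (subst rho_superset[of "{b}"]) auto

lemma rho_Sum_any_single:
  assumes "finite {r. c r \<noteq> 0}"
  shows "rho (Sum_any (\<lambda>r. Poly_Mapping.single (B r) (c r))) f u = Sum_any (\<lambda>r. c r * act (B r) f u)"
proof -
  have "Sum_any (\<lambda>r. Poly_Mapping.single (B r) (c r)) = (\<Sum>r | c r \<noteq> 0. Poly_Mapping.single (B r) (c r))"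
    using assms by (intro Sum_any.expand_superset) auto
  moreover have "Sum_any (\<lambda>r. c r * act (B r) f u) = (\<Sum>r | c r \<noteq> 0. c r * act (B r) f u)"
    using assms by (intro Sum_any.expand_superset) auto
  ultimately show ?thesis by (simp add: rho_sum)
qed

lemma finite_structure_constants:
  "finite {r. of_nat (tree_beta r s t) \<noteq> (0::complex)}"
  "finite {r. of_nat (tree_beta s t r) \<noteq> (0::complex)}"
  "finite {r. of_nat (tree_alpha s t r) \<noteq> (0::complex)}"
  "finite {r. of_nat (tree_alpha s r t) \<noteq> (0::complex)}"
  by (simp_all only: of_nat_eq_0_iff tree_beta_nonzero_iff tree_alpha_nonzero_iff finite_grafted)

lemma Sum_any_diff:
  fixes f g :: "'a \<Rightarrow> 'b::ab_group_add"
  assumes "finite {a. f a \<noteq> 0}" "finite {a. g a \<noteq> 0}"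
  shows "Sum_any (\<lambda>a. f a - g a) = Sum_any f - Sum_any g"
proof -
  let ?A = "{a. f a \<noteq> 0} \<union> {a. g a \<noteq> 0}"
  have *: "Sum_any h = sum h ?A" if "{a. h a \<noteq> 0} \<subseteq> ?A" for h :: "'a \<Rightarrow> 'b"
    using assms that by (intro Sum_any.expand_superset) auto
  have "{a. f a - g a \<noteq> 0} \<subseteq> ?A"
  proof
    fix a assume "a \<in> {a. f a - g a \<noteq> 0}"
    then show "a \<in> ?A" by (cases "f a = 0") auto
  qed
  then have "Sum_any (\<lambda>a. f a - g a) = sum (\<lambda>a. f a - g a) ?A" by (rule *)
  moreover have "Sum_any f = sum f ?A" "Sum_any g = sum g ?A" by (rule *, simp)+
  ultimately show ?thesis by (simp add: sum_subtractf)
qed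

lemma finite_support_mult:
  fixes c :: "'a \<Rightarrow> complex"
  shows "finite {r. c r \<noteq> 0} \<Longrightarrow> finite {r. c r * g r \<noteq> 0}"
  by (rule finite_subset[of _ "{r. c r \<noteq> 0}"]) auto

lemma rho_Sum_any_diff:
  assumes "finite {r. c r \<noteq> 0}" "finite {r. d r \<noteq> 0}"
  shows "rho (Sum_any (\<lambda>r. Poly_Mapping.single (B r) (c r - d r))) f u =
    Sum_any (\<lambda>r. c r * act (B r) f u) - Sum_any (\<lambda>r. d r * act (B r) f u)"
proof -
  have "finite {r. c r - d r \<noteq> 0}"
    by (rule finite_subset[of _ "{r. c r \<noteq> 0} \<union> {r. d r \<noteq> 0}"]) (use assms in auto)
  then show ?thesis
    using assms by (simp add: rho_Sum_any_single Sum_any_diff finite_support_mult left_diff_distrib)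
qed

text \<open>For \<open>s = t\<close> only the new edge contributes in \<open>prune_attach\<close>: no tree is a proper part of itself, so the two families
of structure constants vanish, in agreement with the special case in the definition.\<close>

lemma rho_mixed:
  "rho (ie_mixed s t) f u = act (DPlus t) (act (DMinus s) f) u - act (DMinus s) (act (DPlus t) f) u"
proof -
  have u: "tree_of (rep_rtree u) = u" "card (verts (rep_rtree u)) = tree_size u"
    by (simp_all add: tree_size_def)
  have R: "act (DPlus t) (act (DMinus s) f) u - act (DMinus s) (act (DPlus t) f) u =
    kronecker s t * of_nat (tree_size u) * f u + 
    Sum_any (\<lambda>r. of_nat (tree_beta s t r) * act (DMinus r) f u) +
    Sum_any (\<lambda>r. of_nat (tree_alpha s t r) * act (DPlus r) f u)"
    using prune_attach[OF rooted_tree_rep[of u], of t s f] u by (simp add: act.simps[abs_def])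
  show ?thesis
  proof (cases "s = t")
    case True
    have "\<not> grafted t t r" for r
      using grafted_size[of t t r] tree_size_pos[of r] by auto
    then have "tree_beta t t r = 0" "tree_alpha t t r = 0" for r
      using tree_beta_nonzero_iff tree_alpha_nonzero_iff by blast+
    then show ?thesis unfolding R using True by (simp add: ie_mixed_def kronecker_def)
  next
    case False
    then show ?thesis unfolding R
      by (simp add: ie_mixed_def kronecker_def rho_add rho_Sum_any_single finite_structure_constants[simplified])
  qed
qed

lemma act_eq:
  "act D f = (\<lambda>u. of_nat (tree_size u) * f u)"
  "act (DPlus t) f = (\<lambda>u. attach t f (rep_rtree u))"
  "act (DMinus t) f = (\<lambda>u. prune t f (rep_rtree u))"
  by auto

lemma rho_basis_bracket:
  "rho (ie_basis_bracket a b) f u = act b (act a f) u - act a (act b f) u"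
proof -
  let ?u = "rep_rtree u"
  have u: "rooted_tree ?u" by (rule rooted_tree_rep)
  have sP: "attach t (\<lambda>w. of_nat (tree_size w) * f w) ?u =
      (of_nat (tree_size u) + of_nat (tree_size t)) * attach t f ?u" for t
    unfolding attach_def sum_distrib_left
    by (intro sum.cong refl) (simp add: tree_size_graft u rooted_tree_rep)
  have sM: "prune t (\<lambda>w. of_nat (tree_size w) * f w) ?u =
      (of_nat (tree_size u) - of_nat (tree_size t)) * prune t f ?u" for t
    unfolding prune_def sum_distrib_left
  proof (intro sum.cong refl)
    fix e assume e: "e \<in> edges ?u"
    have "of_nat (tree_size (tree_of (remaining_part ?u e))) =
        (of_nat (tree_size u) - of_nat (tree_size t) :: complex)" if "t = tree_of (pruned_part ?u e)"
    proof -
      obtain a where a: "joinable (remaining_part ?u e) a (pruned_part ?u e)"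
          "?u = join (remaining_part ?u e) a (pruned_part ?u e)"
        using cut_edge[OF u e] .
      note A = joinableD[OF a(1)]
      have "tree_size u = tree_size (tree_of (join (remaining_part ?u e) a (pruned_part ?u e)))"
        using a(2) by (metis tree_of_rep)
      then have "tree_size u = tree_size (tree_of (remaining_part ?u e)) + tree_size t"
        by (simp only: tree_of_join_eq_graft[OF a(1)] tree_size_graft[OF A(1-3)] that)
      then show ?thesis by simp
    qed
    then show "kronecker t (tree_of (pruned_part ?u e)) *
        (of_nat (tree_size (tree_of (remaining_part ?u e))) * f (tree_of (remaining_part ?u e))) =
      (of_nat (tree_size u) - of_nat (tree_size t)) *
        (kronecker t (tree_of (pruned_part ?u e)) * f (tree_of (remaining_part ?u e)))"
      by (simp add: kronecker_def)
  qed
  show ?thesis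
  proof (cases a; cases b)
    fix s t assume ab: "a = DPlus s" "b = DPlus t"
    show ?thesis
      using attach_commutator[OF u, of t s f] finite_structure_constants
      by (simp add: ab act.simps[abs_def] rho_Sum_any_diff)
  next
    fix s t assume ab: "a = DMinus s" "b = DMinus t"
    show ?thesis
      using prune_commutator[OF u, of t s f] finite_structure_constants
      by (simp add: ab act.simps[abs_def] rho_Sum_any_diff)
  qed (simp_all only: ie_basis_bracket.simps rho_mixed rho_uminus rho_single rho_zero
         act_eq sP sM, simp_all add: algebra_simps)
qed

lemma act_linear: "act b (\<lambda>w. c * f w + d * g w) u = c * act b f u + d * act b g u"
  by (cases b) (simp_all add: attach_def prune_def sum_distrib_left sum.distrib algebra_simps)

lemma rho_linear: "rho x (\<lambda>w. c * f w + d * g w) u = c * rho x f u + d * rho x g u"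
  unfolding rho_def act_linear by (simp add: sum_distrib_left sum.distrib algebra_simps)

lemma rho_linear_simps:
  "rho x (\<lambda>w. f w + g w) u = rho x f u + rho x g u"
  "rho x (\<lambda>w. f w - g w) u = rho x f u - rho x g u"
  "rho x (\<lambda>w. c * f w) u = c * rho x f u"
  using rho_linear[of x 1 f 1 g u] rho_linear[of x 1 f "- 1" g u] rho_linear[of x c f 0 f u] by simp_all

lemma rho_bracket: "rho (ie_bracket x y) f u = rho y (rho x f) u - rho x (rho y f) u"
proof -
  let ?K = Poly_Mapping.keys and ?l = Poly_Mapping.lookup
  have yx: "rho y (rho x f) u = (\<Sum>b\<in>?K y. \<Sum>a\<in>?K x. ?l x a * ?l y b * act b (act a f) u)" for x y
    unfolding rho_def[of y] rho_def[of x, abs_def] act_sum sum_distrib_left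
    by (intro sum.cong refl) simp
  have "rho (ie_bracket x y) f u = (\<Sum>a\<in>?K x. \<Sum>b\<in>?K y. ?l x a * ?l y b * act b (act a f) u) -
      (\<Sum>a\<in>?K x. \<Sum>b\<in>?K y. ?l x a * ?l y b * act a (act b f) u)"
    unfolding ie_bracket_def rho_sum rho_scale rho_basis_bracket
    by (simp only: right_diff_distrib sum_subtractf)
  also have "(\<Sum>a\<in>?K x. \<Sum>b\<in>?K y. ?l x a * ?l y b * act b (act a f) u) = rho y (rho x f) u"
    unfolding yx by (rule sum.swap)
  also have "(\<Sum>a\<in>?K x. \<Sum>b\<in>?K y. ?l x a * ?l y b * act a (act b f) u) = rho x (rho y f) u"
    unfolding yx by (simp only: mult_ac)
  finally show ?thesis .
qed

text \<open>The coefficients are read off at the one-vertex tree, where \<open>d\<close> is the identity, each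
attaching operator evaluates at a different tree and pruning gives zero; and at the trees with one
root branch, where pruning down to a single vertex detects exactly one tree.\<close>

lemma rho_faithful_zero:
  assumes "\<And>f u. rho x f u = 0"
  shows "x = 0"
proof (rule poly_mapping_eqI)
  let ?K = Poly_Mapping.keys and ?l = Poly_Mapping.lookup
  have coeff: "?l x b0 = 0" if "\<And>b. act b f u = (if b = b0 then 1 else 0)" for b0 f u
  proof -
    have "rho x f u = (\<Sum>b\<in>?K x. if b = b0 then ?l x b0 else 0)"
      unfolding rho_def that by (intro sum.cong refl) auto
    also have "\<dots> = ?l x b0" by (simp add: sum.delta in_keys_iff)
    finally show ?thesis using assms by simp
  qed
  have size: "kronecker bullet v = 0" if "tree_size v > 1" for v
    using that by (auto simp: kronecker_def)
  have bul: "attach t f (rep_rtree bullet) = f (root_up t)" "prune t f (rep_rtree bullet) = 0" for t f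
    using attach_rep_tree_of[OF rooted_tree_bullet, of t f] prune_rep_tree_of[OF rooted_tree_bullet, of t f]
    by (simp_all add: bullet_def[symmetric] attach_def prune_def root_up_def)
  have up: "tree_size (root_up t) > 1" for t
    using tree_size_pos[of t] by (simp add: tree_size_root_up)
  have att0: "attach s (kronecker bullet) (rep_rtree w) = 0" for s w
    unfolding attach_def using tree_size_pos[of w] tree_size_pos[of s]
    by (intro sum.neutral ballI size) (simp add: tree_size_graft rooted_tree_rep)
  fix b0
  have "?l x b0 = 0"
  proof (cases b0)
    case D
    have "act b (kronecker bullet) bullet = (if b = D then 1 else 0)" for b
      using size[OF up] by (cases b) (auto simp: att0 bul kronecker_def)
    then show ?thesis using coeff D by blast
  next
    case (DPlus t)
    have "act b (kronecker (root_up t)) bullet = (if b = DPlus t then 1 else 0)" for b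
      using up[of t] by (cases b) (auto simp: bul kronecker_def root_up_eq_iff)
    then show ?thesis using coeff DPlus by blast
  next
    case (DMinus t)
    have "act b (kronecker bullet) (root_up t) = (if b = DMinus t then 1 else 0)" for b
      using size[OF up[of t]] by (cases b) (auto simp: att0 prune_root_up kronecker_def)
    then show ?thesis using coeff DMinus by blast
  qed
  then show "?l x b0 = ?l 0 b0" by simp
qed

text \<open>Every identity between brackets can now be checked on operators.\<close>

lemma rho_faithful:
  assumes "\<And>f u. rho x f u = rho y f u"
  shows "x = y"
  using rho_faithful_zero[of "x - y"] assms by (simp add: rho_diff)

section \<open>Derivations are inner\<close>

lemma rho_fun:
  "rho (x + y) f = (\<lambda>u. rho x f u + rho y f u)" "rho (x - y) f = (\<lambda>u. rho x f u - rho y f u)"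
  "rho (ie_scale c x) f = (\<lambda>u. c * rho x f u)" "rho (- x) f = (\<lambda>u. - 1 * rho x f u)"
  "rho (ie_bracket x y) f = (\<lambda>u. rho y (rho x f) u - rho x (rho y f) u)"
  by (auto simp: rho_add rho_diff rho_scale rho_uminus rho_bracket)

lemma ie_bracket_add_left: "ie_bracket (x + y) z = ie_bracket x z + ie_bracket y z"
  and ie_bracket_add_right: "ie_bracket z (x + y) = ie_bracket z x + ie_bracket z y"
  and ie_bracket_diff_left: "ie_bracket (x - y) z = ie_bracket x z - ie_bracket y z"
  and ie_bracket_diff_right: "ie_bracket z (x - y) = ie_bracket z x - ie_bracket z y"
  and ie_bracket_scale_left: "ie_bracket (ie_scale c x) z = ie_scale c (ie_bracket x z)"
  and ie_bracket_scale_right: "ie_bracket z (ie_scale c x) = ie_scale c (ie_bracket z x)"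
  by (rule rho_faithful; simp add: rho_fun rho_linear_simps algebra_simps)+

lemma ie_bracket_antisym: "ie_bracket y x = - ie_bracket x y"
  by (rule rho_faithful) (simp add: rho_fun)

text \<open>The Jacobi identity, in the form that says that bracketing with \<open>z\<close> is a derivation.\<close>

lemma ie_bracket_leibniz:
  "ie_bracket (ie_bracket x y) z = ie_bracket (ie_bracket x z) y + ie_bracket x (ie_bracket y z)"
  by (rule rho_faithful) (simp add: rho_fun rho_linear_simps)

lemma vector_space_ie_scale: "vector_space ie_scale"
  by unfold_locales (auto intro!: poly_mapping_eqI simp: lookup_add algebra_simps)

lemma ie_derivation_iff: "\<delta> \<in> Der_ie \<longleftrightarrow>
    (\<forall>x y. \<delta> (x + y) = \<delta> x + \<delta> y) \<and> (\<forall>c x. \<delta> (ie_scale c x) = ie_scale c (\<delta> x)) \<and>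
    (\<forall>x y. \<delta> (ie_bracket x y) = ie_bracket (\<delta> x) y + ie_bracket x (\<delta> y))"
  by (simp add: derivations_def Vector_Spaces.linear_iff vector_space_ie_scale)

lemma inner_imp_derivation: "(\<lambda>x. ie_bracket x y) \<in> Der_ie"
  by (simp add: ie_derivation_iff ie_bracket_add_left ie_bracket_scale_left ie_bracket_leibniz[of _ _ y])

lemma ie_scale_diff: "ie_scale c (x - y) = ie_scale c x - ie_scale c y"
  by (rule poly_mapping_eqI) (simp add: lookup_minus algebra_simps)

lemma derivation_diff:
  assumes "\<delta> \<in> Der_ie" "\<epsilon> \<in> Der_ie"
  shows "(\<lambda>x. \<delta> x - \<epsilon> x) \<in> Der_ie"
  using assms by (simp add: ie_derivation_iff ie_scale_diff ie_bracket_diff_left ie_bracket_diff_right)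

abbreviation basis_vector :: "ie_basis \<Rightarrow> ie_algebra" where
  "basis_vector b \<equiv> Poly_Mapping.single b 1"

fun weight :: "ie_basis \<Rightarrow> int" where
  "weight D = 0"
| "weight (DPlus t) = int (tree_size t)"
| "weight (DMinus t) = - int (tree_size t)"

lemma weight_eq_0_iff [simp]: "weight b = 0 \<longleftrightarrow> b = D"
proof -
  have "tree_size t \<noteq> 0" for t using tree_size_pos[of t] by simp
  then show ?thesis by (cases b) auto
qed

lemma ie_basis_bracket_D: "ie_basis_bracket D b = Poly_Mapping.single b (of_int (weight b))"
  by (cases b) auto

lemma ie_bracket_basis: "ie_bracket (basis_vector a) (basis_vector b) = ie_basis_bracket a b"
  by (rule poly_mapping_eqI) (simp add: ie_bracket_def)

lemma lookup_ie_bracket_basis: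
  "Poly_Mapping.lookup (ie_bracket (basis_vector a) y) c =
    (\<Sum>b\<in>Poly_Mapping.keys y. Poly_Mapping.lookup y b * Poly_Mapping.lookup (ie_basis_bracket a b) c)"
  by (simp add: ie_bracket_def lookup_sum)

lemma lookup_ie_bracket_D:
  "Poly_Mapping.lookup (ie_bracket (basis_vector D) y) c = of_int (weight c) * Poly_Mapping.lookup y c"
proof -
  have "Poly_Mapping.lookup (ie_bracket (basis_vector D) y) c =
    (\<Sum>b\<in>Poly_Mapping.keys y. if b = c then Poly_Mapping.lookup y c * of_int (weight c) else 0)"
    unfolding lookup_ie_bracket_basis ie_basis_bracket_D
    by (intro sum.cong refl) (auto simp: lookup_single when_def)
  then show ?thesis by (simp add: sum.delta in_keys_iff mult.commute)
qed

lemma sum_basis_vectors: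
  "x = (\<Sum>b\<in>Poly_Mapping.keys x. ie_scale (Poly_Mapping.lookup x b) (basis_vector b))"
proof (rule poly_mapping_eqI)
  fix c
  have "Poly_Mapping.lookup (\<Sum>b\<in>Poly_Mapping.keys x. ie_scale (Poly_Mapping.lookup x b) (basis_vector b)) c =
    (\<Sum>b\<in>Poly_Mapping.keys x. if b = c then Poly_Mapping.lookup x c else 0)"
    unfolding lookup_sum by (intro sum.cong refl) (auto simp: lookup_single when_def)
  then show "Poly_Mapping.lookup x c =
    Poly_Mapping.lookup (\<Sum>b\<in>Poly_Mapping.keys x. ie_scale (Poly_Mapping.lookup x b) (basis_vector b)) c"
    by (simp add: sum.delta in_keys_iff)
qed

lemma derivation_eq_zeroI:
  assumes \<Delta>: "\<Delta> \<in> Der_ie" and zero: "\<And>b. b \<in> Poly_Mapping.keys x \<Longrightarrow> \<Delta> (basis_vector b) = 0"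
  shows "\<Delta> x = 0"
proof -
  have add: "\<Delta> (x + y) = \<Delta> x + \<Delta> y" and scale: "\<Delta> (ie_scale c x) = ie_scale c (\<Delta> x)" for c x y
    using \<Delta> by (auto simp: ie_derivation_iff)
  have "\<Delta> 0 = 0" using add[of 0 0] by simp
  then have "\<Delta> (sum g I) = (\<Sum>i\<in>I. \<Delta> (g i))" for g and I :: "ie_basis set"
    by (induction I rule: infinite_finite_induct) (auto simp: add)
  moreover have "ie_scale c 0 = 0" for c by (rule poly_mapping_eqI) simp
  ultimately have "\<Delta> (\<Sum>b\<in>Poly_Mapping.keys x. ie_scale (Poly_Mapping.lookup x b) (basis_vector b)) = 0"
    using zero by (simp add: scale)
  then show ?thesis using sum_basis_vectors[of x] by simp
qed

lemma lookup_ie_mixed: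
  assumes "s \<noteq> t"
  shows "Poly_Mapping.lookup (ie_mixed s t) (DPlus r) = of_nat (tree_alpha s t r)"
    "Poly_Mapping.lookup (ie_mixed s t) (DMinus r) = of_nat (tree_beta s t r)"
    "Poly_Mapping.lookup (ie_mixed s t) D = 0"
proof -
  have inj: "inj DPlus" "inj DMinus" by (auto simp: inj_def)
  note A = lookup_Sum_any_single[OF finite_structure_constants(3)[of s t] inj(1)]
  note B = lookup_Sum_any_single[OF finite_structure_constants(2)[of s t] inj(2)]
  show "Poly_Mapping.lookup (ie_mixed s t) (DPlus r) = of_nat (tree_alpha s t r)"
    "Poly_Mapping.lookup (ie_mixed s t) (DMinus r) = of_nat (tree_beta s t r)"
    "Poly_Mapping.lookup (ie_mixed s t) D = 0"
    using assms by (simp_all add: ie_mixed_def lookup_add A B image_iff)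
qed

fun basis_size :: "ie_basis \<Rightarrow> nat" where
  "basis_size D = 0"
| "basis_size (DPlus t) = tree_size t"
| "basis_size (DMinus t) = tree_size t"

text \<open>The induction in \<open>normalised_derivation_eq_0\<close> stays within smaller trees because a cut strictly
decreases the size.\<close>

lemma basis_size_ie_mixed:
  assumes "s \<noteq> t" "tree_size s \<le> n" "tree_size t \<le> n" "b \<in> Poly_Mapping.keys (ie_mixed s t)"
  shows "basis_size b < n"
proof -
  have b: "Poly_Mapping.lookup (ie_mixed s t) b \<noteq> 0" using assms(4) by (simp add: in_keys_iff)
  show ?thesis
  proof (cases b)
    case D
    then show ?thesis using assms(2) tree_size_pos[of s] by simp
  next
    case (DPlus r)
    then have "grafted t s r" using b assms(1) by (simp add: lookup_ie_mixed flip: tree_alpha_nonzero_iff)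
    then show ?thesis using grafted_size[of t s r] tree_size_pos[of s] assms(3) DPlus by simp
  next
    case (DMinus r)
    then have "grafted s t r" using b assms(1) by (simp add: lookup_ie_mixed flip: tree_beta_nonzero_iff)
    then show ?thesis using grafted_size[of s t r] tree_size_pos[of t] assms(2) DMinus by simp
  qed
qed

text \<open>The hypotheses remove the freedom of adding an inner derivation. In the induction on size, the
one-vertex tree has to be treated apart, since it has no cuts: there the two conditions come from the
hypothesis and from \<open>[D\<^sup>-, D\<^sup>+] = d\<close>.\<close>

lemma normalised_derivation_eq_0:
  assumes \<Delta>: "\<Delta> \<in> Der_ie"
    and D: "\<And>b. b \<noteq> D \<Longrightarrow> Poly_Mapping.lookup (\<Delta> (basis_vector D)) b = 0"
    and bul: "Poly_Mapping.lookup (\<Delta> (basis_vector (DPlus bullet))) (DPlus bullet) = 0"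
  shows "\<Delta> x = 0"
proof -
  let ?l = Poly_Mapping.lookup and ?K = Poly_Mapping.keys and ?e = basis_vector
  have scale: "\<Delta> (ie_scale c x) = ie_scale c (\<Delta> x)" 
    and der: "\<Delta> (ie_bracket x y) = ie_bracket (\<Delta> x) y + ie_bracket x (\<Delta> y)" for c x y
    using \<Delta> by (auto simp: ie_derivation_iff)
  have br0: "ie_bracket 0 y = 0" "ie_bracket y 0 = 0" for y by (simp_all add: ie_bracket_def)
  define c where "c = ?l (\<Delta> (?e D)) D"
  have \<Delta>D: "\<Delta> (?e D) = ie_scale c (?e D)"
  proof (rule poly_mapping_eqI)
    fix b show "?l (\<Delta> (?e D)) b = ?l (ie_scale c (?e D)) b"
      using D[of b] by (cases "b = D") (auto simp: c_def lookup_single)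
  qed
  have weights: "of_int (weight b) * ?l (\<Delta> (?e b)) b' =
      c * ?l (Poly_Mapping.single b (of_int (weight b))) b' + of_int (weight b') * ?l (\<Delta> (?e b)) b'" for b b'
  proof -
    have "ie_bracket (?e D) (?e b) = ie_scale (of_int (weight b)) (?e b)"
      unfolding ie_bracket_basis ie_basis_bracket_D
      by (rule poly_mapping_eqI) (simp add: lookup_single when_def)
    then have "ie_scale (of_int (weight b)) (\<Delta> (?e b)) =
        ie_bracket (\<Delta> (?e D)) (?e b) + ie_bracket (?e D) (\<Delta> (?e b))"
      using der[of "?e D" "?e b"] scale by simp
    also have "ie_bracket (\<Delta> (?e D)) (?e b) = ie_scale c (Poly_Mapping.single b (of_int (weight b)))"
      by (simp add: \<Delta>D ie_bracket_scale_left ie_bracket_basis ie_basis_bracket_D)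
    finally have "?l (ie_scale (of_int (weight b)) (\<Delta> (?e b))) b' =
        ?l (ie_scale c (Poly_Mapping.single b (of_int (weight b))) + ie_bracket (?e D) (\<Delta> (?e b))) b'"
      by simp
    then show ?thesis by (simp add: lookup_add lookup_ie_bracket_D)
  qed
  \<comment> \<open>comparing coefficients of a basis vector in its own image leaves only \<open>c\<close> times its weight\<close>
  have "c = 0" using weights[of "DPlus bullet" "DPlus bullet"] by simp
  then have hom: "weight b' = weight b" if "b' \<in> ?K (\<Delta> (?e b))" for b b'
    using weights[of b b'] that by (simp add: in_keys_iff)
  have size: "\<exists>t'. b' = DPlus t' \<and> tree_size t' = tree_size t" if "b' \<in> ?K (\<Delta> (?e (DPlus t)))" for t b'
    using hom[OF that] tree_size_pos[of t] by (cases b') auto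
  have size': "\<exists>t'. b' = DMinus t' \<and> tree_size t' = tree_size t" if "b' \<in> ?K (\<Delta> (?e (DMinus t)))" for t b'
    using hom[OF that] tree_size_pos[of t] by (cases b') auto
  have \<Delta>_bullet: "\<Delta> (?e (DPlus bullet)) = 0"
  proof (rule poly_mapping_eqI)
    fix b' show "?l (\<Delta> (?e (DPlus bullet))) b' = ?l 0 b'"
      using size[of b' bullet] bul tree_size_eq_1_iff
      by (cases "b' \<in> ?K (\<Delta> (?e (DPlus bullet)))") (auto simp: in_keys_iff)
  qed
  have main: "\<Delta> (?e b) = 0" if "basis_size b = n" for b n
    using that
  proof (induction n arbitrary: b rule: less_induct)
    case (less n)
    have IH: "\<Delta> (?e b) = 0" if "basis_size b < n" for b using less.IH[OF that] by simp
    have mixed: "\<Delta> (ie_mixed s t) = 0" if "s \<noteq> t" "tree_size s \<le> n" "tree_size t \<le> n" for s t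
      by (rule derivation_eq_zeroI[OF \<Delta>]) (use basis_size_ie_mixed[OF that] IH in auto)
    show ?case
    proof (cases b)
      case D
      then show ?thesis using \<Delta>D \<open>c = 0\<close> by (auto intro: poly_mapping_eqI)
    next
      case b: (DPlus t)
      have n: "tree_size t = n" using less.prems b by simp
      show ?thesis
      proof (cases "n = 1")
        case True
        then have t: "t = bullet" using n tree_size_eq_1_iff by simp
        then show ?thesis using \<Delta>_bullet b by simp
      next
        case False
        then have n2: "n \<ge> 2" using n tree_size_pos[of t] by simp
        define A where "A = DPlus -` ?K (\<Delta> (?e b))"
        have KA: "?K (\<Delta> (?e b)) = DPlus ` A" using size[of _ t] b unfolding A_def image_vimage_eq by blast
        have finA: "finite A" unfolding A_def by (rule finite_vimageI) (auto simp: inj_def)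
        have sizeA: "tree_size t' = n" if "t' \<in> A" for t' using that size[of "DPlus t'" t] b n by (auto simp: A_def)
        have "?l (\<Delta> (?e b)) (DPlus t') = 0" if "t' \<in> A" for t'
        proof (rule grafting_separates_trees[OF finA sizeA n2 _ _ that])
          show "of_nat (tree_alpha s t r) \<noteq> (0::complex) \<longleftrightarrow> grafted t s r" for s t r
            by (simp add: tree_alpha_nonzero_iff del: neq0_conv)
          fix s r assume sr: "tree_size s + tree_size r = n"
          then have s: "tree_size s < n" using tree_size_pos[of r] by simp
          have "\<Delta> (ie_bracket (?e (DMinus s)) (?e b)) = 0"
            unfolding ie_bracket_basis b ie_basis_bracket.simps using s n by (intro mixed) auto
          then have "ie_bracket (?e (DMinus s)) (\<Delta> (?e b)) = 0"
            using der[of "?e (DMinus s)" "?e b"] IH[of "DMinus s"] s br0 by simp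
          then have "0 = (\<Sum>t\<in>A. ?l (\<Delta> (?e b)) (DPlus t) * ?l (ie_mixed s t) (DPlus r))"
            using lookup_ie_bracket_basis[of "DMinus s" "\<Delta> (?e b)" "DPlus r"]
            by (simp add: KA sum.reindex inj_on_def)
          also have "\<dots> = (\<Sum>t\<in>A. ?l (\<Delta> (?e b)) (DPlus t) * of_nat (tree_alpha s t r))"
          proof (intro sum.cong refl)
            fix t assume "t \<in> A"
            then have "s \<noteq> t" using sizeA s by auto
            then show "?l (\<Delta> (?e b)) (DPlus t) * ?l (ie_mixed s t) (DPlus r) =
              ?l (\<Delta> (?e b)) (DPlus t) * of_nat (tree_alpha s t r)" by (simp add: lookup_ie_mixed)
          qed
          finally show "(\<Sum>t\<in>A. ?l (\<Delta> (?e b)) (DPlus t) * of_nat (tree_alpha s t r)) = 0" ..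
        qed
        then have "A = {}" by (auto simp: A_def in_keys_iff)
        then show ?thesis using KA by simp
      qed
    next
      case b: (DMinus t)
      have n: "tree_size t = n" using less.prems b by simp
      show ?thesis
      proof (cases "n = 1")
        case True
        then have t: "t = bullet" using n tree_size_eq_1_iff by simp
        define k where "k = ?l (\<Delta> (?e b)) b"
        have \<Delta>b: "\<Delta> (?e b) = ie_scale k (?e b)"
        proof (rule poly_mapping_eqI)
          fix b' show "?l (\<Delta> (?e b)) b' = ?l (ie_scale k (?e b)) b'"
            using size'[of b' t] b t tree_size_eq_1_iff
            by (cases "b' \<in> ?K (\<Delta> (?e b))") (auto simp: k_def in_keys_iff lookup_single)
        qed
        have eD: "ie_bracket (?e b) (?e (DPlus bullet)) = ?e D"
          by (simp add: ie_bracket_basis b t ie_mixed_def)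
        have "\<Delta> (?e D) = ie_scale k (?e D)"
          using der[of "?e b" "?e (DPlus bullet)"] by (simp add: eD \<Delta>b \<Delta>_bullet br0 ie_bracket_scale_left)
        then have "k = 0" using \<Delta>D \<open>c = 0\<close> by (metis lookup_ie_scale lookup_single_eq mult_1_right)
        then show ?thesis using \<Delta>b by (auto intro: poly_mapping_eqI)
      next
        case False
        then have n2: "n \<ge> 2" using n tree_size_pos[of t] by simp
        define A where "A = DMinus -` ?K (\<Delta> (?e b))"
        have KA: "?K (\<Delta> (?e b)) = DMinus ` A" using size'[of _ t] b unfolding A_def image_vimage_eq by blast
        have finA: "finite A" unfolding A_def by (rule finite_vimageI) (auto simp: inj_def)
        have sizeA: "tree_size t' = n" if "t' \<in> A" for t' using that size'[of "DMinus t'" t] b n by (auto simp: A_def)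
        have "?l (\<Delta> (?e b)) (DMinus t') = 0" if "t' \<in> A" for t'
        proof (rule grafting_separates_trees[OF finA sizeA n2 _ _ that])
          show "of_nat (tree_beta t s r) \<noteq> (0::complex) \<longleftrightarrow> grafted t s r" for s t r
            by (simp add: tree_beta_nonzero_iff del: neq0_conv)
          fix s r assume sr: "tree_size s + tree_size r = n"
          then have s: "tree_size s < n" using tree_size_pos[of r] by simp
          have "\<Delta> (ie_mixed t s) = 0" using s n by (intro mixed) auto
          moreover have "ie_mixed t s = ie_bracket (?e b) (?e (DPlus s))"
            by (simp add: ie_bracket_basis b)
          ultimately have "ie_bracket (\<Delta> (?e b)) (?e (DPlus s)) = 0"
            using der[of "?e b" "?e (DPlus s)"] IH[of "DPlus s"] s br0 by simp
          then have "ie_bracket (?e (DPlus s)) (\<Delta> (?e b)) = 0"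
            using ie_bracket_antisym[of "?e (DPlus s)" "\<Delta> (?e b)"] by simp
          then have "0 = (\<Sum>t\<in>A. ?l (\<Delta> (?e b)) (DMinus t) * ?l (ie_mixed t s) (DMinus r))"
            using lookup_ie_bracket_basis[of "DPlus s" "\<Delta> (?e b)" "DMinus r"]
            by (simp add: KA sum.reindex inj_on_def sum_negf)
          also have "\<dots> = (\<Sum>t\<in>A. ?l (\<Delta> (?e b)) (DMinus t) * of_nat (tree_beta t s r))"
          proof (intro sum.cong refl)
            fix t assume "t \<in> A"
            then have "s \<noteq> t" using sizeA s by auto
            then show "?l (\<Delta> (?e b)) (DMinus t) * ?l (ie_mixed t s) (DMinus r) =
              ?l (\<Delta> (?e b)) (DMinus t) * of_nat (tree_beta t s r)" by (simp add: lookup_ie_mixed)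
          qed
          finally show "(\<Sum>t\<in>A. ?l (\<Delta> (?e b)) (DMinus t) * of_nat (tree_beta t s r)) = 0" ..
        qed
        then have "A = {}" by (auto simp: A_def in_keys_iff)
        then show ?thesis using KA by simp
      qed
    qed
  qed
  show ?thesis by (rule derivation_eq_zeroI[OF \<Delta>]) (rule main[OF refl])
qed

text \<open>The element \<open>z\<close> solves \<open>[d, z] = \<delta> d\<close> in all nonzero weights; at \<open>d\<close> itself the division by the weight
\<open>0\<close> gives \<open>0\<close>, which is harmless. The remaining multiple of \<open>d\<close> is fixed by \<open>k\<close>.\<close>

lemma derivation_imp_inner:
  assumes \<delta>: "\<delta> \<in> Der_ie"
  shows "\<exists>y. \<delta> = (\<lambda>x. ie_bracket x y)"
proof -
  let ?l = Poly_Mapping.lookup and ?K = Poly_Mapping.keys and ?e = basis_vector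
  define z where "z = (\<Sum>b\<in>?K (\<delta> (?e D)). Poly_Mapping.single b (?l (\<delta> (?e D)) b / of_int (weight b)))"
  have z: "?l z b = ?l (\<delta> (?e D)) b / of_int (weight b)" for b
  proof -
    have "?l z b = (\<Sum>b'\<in>?K (\<delta> (?e D)). if b' = b then ?l (\<delta> (?e D)) b / of_int (weight b) else 0)"
      unfolding z_def lookup_sum by (intro sum.cong refl) (auto simp: lookup_single when_def)
    then show ?thesis by (simp add: sum.delta in_keys_iff)
  qed
  define k where "k = ?l (\<delta> (?e (DPlus bullet)) - ie_bracket (?e (DPlus bullet)) z) (DPlus bullet)"
  define y where "y = z - ie_scale k (?e D)"
  define \<Delta> where "\<Delta> = (\<lambda>x. \<delta> x - ie_bracket x y)"
  have "\<Delta> x = 0" for x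
  proof (rule normalised_derivation_eq_0[of \<Delta>])
    show "\<Delta> \<in> Der_ie" unfolding \<Delta>_def by (intro derivation_diff \<delta> inner_imp_derivation)
    show "?l (\<Delta> (?e D)) b = 0" if "b \<noteq> D" for b
      using that by (simp add: \<Delta>_def lookup_minus lookup_ie_bracket_D y_def z lookup_single)
    have "ie_bracket (?e (DPlus bullet)) (?e D) = - ?e (DPlus bullet)"
      by (simp add: ie_bracket_basis single_uminus)
    then show "?l (\<Delta> (?e (DPlus bullet))) (DPlus bullet) = 0"
      by (simp add: \<Delta>_def y_def ie_bracket_diff_right ie_bracket_scale_right lookup_minus k_def)
  qed
  then have "\<delta> = (\<lambda>x. ie_bracket x y)" by (simp add: \<Delta>_def fun_eq_iff)
  then show ?thesis by blast
qed

lemma Z1_eq_Der: "Z1_ie = Der_ie"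
proof -
  have "CE_d1 ie_bracket ie_bracket f x y = 0 \<longleftrightarrow>
      f (ie_bracket x y) = ie_bracket (f x) y + ie_bracket x (f y)" for f x y
    unfolding CE_d1_def ie_bracket_antisym[of y "f x"] by (auto simp: algebra_simps)
  then show ?thesis by (simp add: CE_Z1_def derivations_def)
qed

lemma B1_eq_Inn: "B1_ie = Inn_ie"
  by (auto simp: CE_B1_def CE_d0_def inner_derivations_def)

lemma quotients_isomorphic_refl: "quotients_isomorphic sc Z B sc Z B"
  unfolding quotients_isomorphic_def by (rule exI[of _ id]) auto

lemma inner_coset:
  assumes "f \<in> Inn_ie"
  shows "f +o Inn_ie = Inn_ie"
proof
  obtain y where f: "f = (\<lambda>x. ie_bracket x y)" using assms by (auto simp: inner_derivations_def)
  show "f +o Inn_ie \<subseteq> Inn_ie"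
    by (auto simp: f elt_set_plus_def inner_derivations_def plus_fun_def simp flip: ie_bracket_add_right)
  show "Inn_ie \<subseteq> f +o Inn_ie"
  proof
    fix g assume "g \<in> Inn_ie"
    then obtain z where g: "g = (\<lambda>x. ie_bracket x z)" by (auto simp: inner_derivations_def)
    then have "g = f + (\<lambda>x. ie_bracket x (z - y))"
      by (simp add: f plus_fun_def ie_bracket_diff_right)
    then show "g \<in> f +o Inn_ie" by (auto simp: elt_set_plus_def inner_derivations_def)
  qed
qed

theorem corollary7p4:
  "Der_ie = Inn_ie
   \<and> quotients_isomorphic
       (pointwise_scale ie_scale) Z1_ie B1_ie (pointwise_scale ie_scale) Der_ie Inn_ie
   \<and> H1_ie = {B1_ie}"
proof -
  have eq: "Der_ie = Inn_ie"
    using derivation_imp_inner inner_imp_derivation by (auto simp: inner_derivations_def)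
  have "(\<lambda>x. ie_bracket x 0) \<in> Inn_ie" by (auto simp: inner_derivations_def)
  then have "(\<lambda>f. f +o Inn_ie) ` Inn_ie = {Inn_ie}" using inner_coset by auto
  then show ?thesis
    by (simp add: Z1_eq_Der B1_eq_Inn eq quotient_space_def quotients_isomorphic_refl)
qed

end
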